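(* Assume there is a polynomial-time $\gamma$-approximation algorithm for makespan minimization on identical machines and a polynomial-time $\gamma_{\mathrm{rob}}$-approximation algorithm for robust makespan minimization over $\mathcal U$ on identical machines. Then, for general (nonempty bounded) uncertainty sets $\mathcal U\subseteq\mathbb R_{\ge0}^n$ and identical machines, for every $\lambda>0$ there is a polynomial-time algorithm with consistency $\gamma(1+2/\lambda)$ and robustness $(2\lambda+4)\gamma_{\mathrm{rob}}$; that is, for every predicted scenario $\hat p\in\mathcal U$ it returns in polynomial time a schedule $\mathcal S$ with $$C_{\max}(\mathcal S,\hat p)\le\gamma\Big(1+\frac2\lambda\Big)\mathrm{OPT}(\hat p)\quad\text{and}\quad\sup_{p\in\mathcal U}C_{\max}(\mathcal S,p)\le(2\lambda+4)\gamma_{\mathrm{rob}}\,\mathrm{OPT}^{\mathrm{rob}}(\mathcal U).$$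
   Context: There are $m$ identical machines and $n$ jobs; a scenario is a vector $p\in\mathbb R_{\ge0}^n$ of job sizes. A schedule is a partition $\mathcal S=(S_1,\dots,S_m)$ of $[n]$ (parts may be empty), and $C_{\max}(\mathcal S,p)=\max_{i\in[m]}\sum_{j\in S_i}p_j$. $\mathrm{OPT}(p)=\min_{\mathcal S}C_{\max}(\mathcal S,p)$ and $\mathrm{OPT}^{\mathrm{rob}}(\mathcal U)=\min_{\mathcal S}\sup_{p\in\mathcal U}C_{\max}(\mathcal S,p)$. A $\gamma$-approximation algorithm for makespan minimization returns on every $p$ a schedule $\mathcal S$ with $C_{\max}(\mathcal S,p)\le\gamma\,\mathrm{OPT}(p)$; a $\gamma_{\mathrm{rob}}$-approximation algorithm for robust makespan minimization over $\mathcal U$ returns a schedule $\mathcal S$ with $\sup_{p\in\mathcal U}C_{\max}(\mathcal S,p)\le\gamma_{\mathrm{rob}}\,\mathrm{OPT}^{\mathrm{rob}}(\mathcal U)$. The uncertainty set may be given implicitly; it is accessed only through the assumed robust approximation algorithm. *)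

theory Defs
  imports Complex_Main "HOL-Computational_Algebra.Polynomial"
begin

section \<open>Robust makespan minimization on identical machines\<close>

text \<open>Machines are \<open>0, \<dots>, m - 1\<close> and jobs are \<open>0, \<dots>, n - 1\<close>.
  A scenario in \<open>\<real>\<^sup>n\<close> with nonnegative entries is a list of length \<open>n\<close>.\<close>

definition scenarios :: "nat \<Rightarrow> real list set" where
  "scenarios n = {p. length p = n \<and> (\<forall>x\<in>set p. 0 \<le> x)}"

definition schedules :: "nat \<Rightarrow> nat \<Rightarrow> nat set list set" where
  "schedules m n = {S. length S = m \<and> \<Union>(set S) = {..<n} \<and>
     (\<forall>i<m. \<forall>k<m. i \<noteq> k \<longrightarrow> S ! i \<inter> S ! k = {})}"

definition makespan :: "nat set list \<Rightarrow> real list \<Rightarrow> real" where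
  "makespan S p = (MAX i\<in>{..<length S}. \<Sum>j\<in>S ! i. p ! j)"

definition worst_makespan :: "nat set list \<Rightarrow> real list set \<Rightarrow> real" where
  "worst_makespan S V = (SUP p\<in>V. makespan S p)"

definition OPT :: "nat \<Rightarrow> real list \<Rightarrow> real" where
  "OPT m p = (MIN S\<in>schedules m (length p). makespan S p)"

definition OPT_rob :: "nat \<Rightarrow> nat \<Rightarrow> real list set \<Rightarrow> real" where
  "OPT_rob m n V = (MIN S\<in>schedules m n. worst_makespan S V)"

definition uncertainty_set :: "nat \<Rightarrow> real list set \<Rightarrow> bool" where
  "uncertainty_set n V \<longleftrightarrow> V \<noteq> {} \<and> V \<subseteq> scenarios n \<and> (\<exists>b. \<forall>p\<in>V. \<forall>x\<in>set p. x \<le> b)"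


section \<open>Model of computation\<close>

text \<open>Scenarios are real vectors, so running time is the number of steps of a real-number
  machine: a WHILE language over binary trees with real leaves, whose unit-cost operations are
  building and taking apart a tree, exact field arithmetic, and comparison of reals.
  There is no rounding operation. A program is a finite text: its constants are rational.

  Trees are immutable and can be shared, so copying a variable or pairing two trees takes constant
  time on a pointer machine. Expressions have a size that is fixed by the program; charging one
  unit for each evaluation therefore changes running times only by a constant factor.\<close>

datatype data = Empty | Num real | Node data data

fun data_size :: "data \<Rightarrow> nat" where
  "data_size Empty = 1"
| "data_size (Num x) = 1"
| "data_size (Node a b) = 1 + data_size a + data_size b"

datatype expr =
    Var nat
  | Const rat
  | EmptyE
  | NodeE expr expr
  | LeftE expr
  | RightE expr
  | Add expr expr
  | Sub expr expr
  | Mul expr expr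
  | Div expr expr
  | Less expr expr
  | IsNum expr

datatype prog =
    Skip
  | Assign nat expr
  | Seq prog prog
  | If expr prog prog
  | While expr prog

type_synonym store = "nat \<Rightarrow> data"

fun left :: "data \<Rightarrow> data" where
  "left (Node a b) = a"
| "left _ = Empty"

fun right :: "data \<Rightarrow> data" where
  "right (Node a b) = b"
| "right _ = Empty"

fun num :: "data \<Rightarrow> real" where
  "num (Num x) = x"
| "num _ = 0"

text \<open>\<open>Empty\<close> is the truth value \<open>False\<close>; every other tree counts as \<open>True\<close>.\<close>

definition truth :: "bool \<Rightarrow> data" where
  "truth b = (if b then Num 1 else Empty)"

fun eval_expr :: "expr \<Rightarrow> store \<Rightarrow> data" where
  "eval_expr (Var x) s = s x"
| "eval_expr (Const r) s = Num (of_rat r)"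
| "eval_expr EmptyE s = Empty"
| "eval_expr (NodeE e f) s = Node (eval_expr e s) (eval_expr f s)"
| "eval_expr (LeftE e) s = left (eval_expr e s)"
| "eval_expr (RightE e) s = right (eval_expr e s)"
| "eval_expr (Add e f) s = Num (num (eval_expr e s) + num (eval_expr f s))"
| "eval_expr (Sub e f) s = Num (num (eval_expr e s) - num (eval_expr f s))"
| "eval_expr (Mul e f) s = Num (num (eval_expr e s) * num (eval_expr f s))"
| "eval_expr (Div e f) s = Num (num (eval_expr e s) / num (eval_expr f s))"
| "eval_expr (Less e f) s = truth (num (eval_expr e s) < num (eval_expr f s))"
| "eval_expr (IsNum e) s = truth (\<exists>x. eval_expr e s = Num x)"

text \<open>\<open>exec c s t s'\<close>: started in \<open>s\<close>, the program \<open>c\<close> halts in \<open>s'\<close> after \<open>t\<close> steps.\<close>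

inductive exec :: "prog \<Rightarrow> store \<Rightarrow> nat \<Rightarrow> store \<Rightarrow> bool" where
  Skip: "exec Skip s 1 s"
| Assign: "exec (Assign x e) s 1 (s(x := eval_expr e s))"
| Seq: "exec c s t s' \<Longrightarrow> exec d s' u s'' \<Longrightarrow> exec (Seq c d) s (t + u) s''"
| IfTrue: "eval_expr e s \<noteq> Empty \<Longrightarrow> exec c s t s' \<Longrightarrow> exec (If e c d) s (1 + t) s'"
| IfFalse: "eval_expr e s = Empty \<Longrightarrow> exec d s t s' \<Longrightarrow> exec (If e c d) s (1 + t) s'"
| WhileFalse: "eval_expr e s = Empty \<Longrightarrow> exec (While e c) s 1 s"
| WhileTrue: "eval_expr e s \<noteq> Empty \<Longrightarrow> exec c s t s' \<Longrightarrow> exec (While e c) s' u s'' \<Longrightarrow>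
    exec (While e c) s (1 + t + u) s''"

inductive_cases SkipE: "exec Skip s t s'"
inductive_cases AssignE: "exec (Assign x e) s t s'"
inductive_cases SeqE: "exec (Seq c d) s t s'"
inductive_cases IfE: "exec (If e c d) s t s'"
inductive_cases WhileE: "exec (While e c) s t s'"

lemma exec_deterministic:
  "exec c s t s' \<Longrightarrow> exec c s u s'' \<Longrightarrow> u = t \<and> s'' = s'"
proof (induction arbitrary: u s'' rule: exec.induct)
  case Skip
  then show ?case by (auto elim: SkipE)
next
  case Assign
  then show ?case by (auto elim: AssignE)
next
  case (Seq c s t s' d u' r)
  from Seq.prems obtain v w r' where "exec c s v r'" "exec d r' w s''" "u = v + w"
    by (rule SeqE)
  with Seq.IH show ?case by blast
next
  case (IfTrue e s c t s' d)
  from IfTrue.prems show ?case using IfTrue.hyps(1) IfTrue.IH by (cases rule: IfE) auto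
next
  case (IfFalse e s d t s' c)
  from IfFalse.prems show ?case using IfFalse.hyps(1) IfFalse.IH by (cases rule: IfE) auto
next
  case (WhileFalse e s c)
  from WhileFalse.prems show ?case using WhileFalse.hyps(1) by (cases rule: WhileE) auto
next
  case (WhileTrue e s c t s' u' r)
  from WhileTrue.prems WhileTrue.hyps(1)
  obtain v r' w where "exec c s v r'" "exec (While e c) r' w s''" "u = 1 + v + w"
    by (auto elim: WhileE)
  with WhileTrue.IH show ?case by blast
qed

text \<open>Input and output are in variable \<open>0\<close>; all other variables are initially \<open>Empty\<close>.\<close>

definition computes :: "prog \<Rightarrow> data \<Rightarrow> nat \<Rightarrow> data \<Rightarrow> bool" where
  "computes c x t y \<longleftrightarrow> (\<exists>s. exec c ((\<lambda>_. Empty)(0 := x)) t s \<and> s 0 = y)"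

text \<open>A problem consists of a set of instances, their encoding as inputs, and the relation between
  an instance and its admissible outputs.\<close>

definition solves_in_poly_time ::
    "prog \<Rightarrow> 'i set \<Rightarrow> ('i \<Rightarrow> data) \<Rightarrow> ('i \<Rightarrow> data \<Rightarrow> bool) \<Rightarrow> bool" where
  "solves_in_poly_time c I enc admissible \<longleftrightarrow>
     (\<exists>q :: nat poly. \<forall>i\<in>I. \<exists>t y. computes c (enc i) t y \<and> t \<le> poly q (data_size (enc i)) \<and>
        admissible i y)"


section \<open>Scheduling algorithms\<close>

definition enc_nat :: "nat \<Rightarrow> data" where
  "enc_nat k = Num (real k)"

definition enc_list :: "real list \<Rightarrow> data" where
  "enc_list xs = foldr (\<lambda>x. Node (Num x)) xs Empty"

text \<open>A schedule is output as the list that assigns a machine to each job.\<close>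

definition schedule_of :: "nat \<Rightarrow> nat list \<Rightarrow> nat set list" where
  "schedule_of m a = map (\<lambda>i. {j. j < length a \<and> a ! j = i}) [0..<m]"

definition represents :: "nat \<Rightarrow> nat \<Rightarrow> data \<Rightarrow> nat set list \<Rightarrow> bool" where
  "represents m n y S \<longleftrightarrow>
     (\<exists>a. length a = n \<and> set a \<subseteq> {..<m} \<and> y = enc_list (map real a) \<and> S = schedule_of m a)"

lemma represents_schedule: "represents m n y S \<Longrightarrow> S \<in> schedules m n"
  by (auto simp: represents_def schedules_def schedule_of_def subset_iff)

lemma schedule_represented:
  assumes "S \<in> schedules m n"
  shows "\<exists>y. represents m n y S"
proof -
  have "\<exists>i<m. j \<in> S ! i" if "j < n" for j
  proof -
    have "j \<in> \<Union>(set S)" using assms that by (auto simp: schedules_def)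
    then show ?thesis using assms by (auto simp: schedules_def in_set_conv_nth)
  qed
  then obtain f where f: "\<And>j. j < n \<Longrightarrow> f j < m \<and> j \<in> S ! f j" by metis
  have "{j. j < n \<and> f j = i} = S ! i" if "i < m" for i
  proof -
    have "S ! i \<in> set S" using assms that by (auto simp: schedules_def)
    then have sub: "S ! i \<subseteq> {..<n}" using assms by (auto simp: schedules_def)
    have "f j = i" if "j \<in> S ! i" for j
    proof (rule ccontr)
      assume "f j \<noteq> i"
      moreover have "j < n" using that sub by auto
      ultimately show False using f[of j] assms that \<open>i < m\<close> by (auto simp: schedules_def)
    qed
    then show ?thesis using sub f by auto
  qed
  moreover have "{j. j < n \<and> map f [0..<n] ! j = i} = {j. j < n \<and> f j = i}" for i
    by auto
  moreover have "length S = m" using assms by (simp add: schedules_def)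
  ultimately have "S = schedule_of m (map f [0..<n])"
    by (intro nth_equalityI) (simp_all add: schedule_of_def)
  then show ?thesis using f unfolding represents_def
    by (intro exI[of _ "enc_list (map real (map f [0..<n]))"] exI[of _ "map f [0..<n]"]) auto
qed

definition makespan_approx_algorithm :: "real \<Rightarrow> prog \<Rightarrow> bool" where
  "makespan_approx_algorithm \<gamma> c \<longleftrightarrow>
     solves_in_poly_time c
       {(m, p). 1 \<le> m \<and> p \<in> scenarios (length p)}
       (\<lambda>(m, p). Node (enc_nat m) (enc_list p))
       (\<lambda>(m, p) y. \<exists>S. represents m (length p) y S \<and> makespan S p \<le> \<gamma> * OPT m p)"

text \<open>Below, \<open>I\<close> is a class of robust instances \<open>(m, n, d)\<close>: number of machines, number of jobs, and
  a description \<open>d\<close> of the uncertainty set \<open>U d\<close>. Neither \<open>I\<close> nor the meaning \<open>U\<close> of descriptions is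
  restricted; a class may consist of one instance. The input lists the jobs, so that its size is at
  least \<open>n\<close> even if \<open>U d\<close> has a short implicit description.\<close>

definition robust_approx_algorithm ::
    "(nat \<times> nat \<times> data) set \<Rightarrow> (data \<Rightarrow> real list set) \<Rightarrow> real \<Rightarrow> prog \<Rightarrow> bool" where
  "robust_approx_algorithm I U \<gamma> c \<longleftrightarrow>
     solves_in_poly_time c I
       (\<lambda>(m, n, d). Node (enc_nat m) (Node (enc_list (map real [0..<n])) d))
       (\<lambda>(m, n, d) y. \<exists>S. represents m n y S \<and>
          worst_makespan S (U d) \<le> \<gamma> * OPT_rob m n (U d))"

text \<open>An algorithm with predictions gets in addition a predicted scenario of the uncertainty set.
  It has consistency \<open>\<alpha>\<close> and robustness \<open>\<beta>\<close>.\<close>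

definition prediction_algorithm ::
    "(nat \<times> nat \<times> data) set \<Rightarrow> (data \<Rightarrow> real list set) \<Rightarrow> real \<Rightarrow> real \<Rightarrow> prog \<Rightarrow> bool" where
  "prediction_algorithm I U \<alpha> \<beta> c \<longleftrightarrow>
     solves_in_poly_time c
       {(m, n, d, p). (m, n, d) \<in> I \<and> p \<in> U d}
       (\<lambda>(m, n, d, p). Node (enc_nat m) (Node (enc_list p) d))
       (\<lambda>(m, n, d, p) y. \<exists>S. represents m n y S \<and>
          makespan S p \<le> \<alpha> * OPT m p \<and>
          worst_makespan S (U d) \<le> \<beta> * OPT_rob m n (U d))"

end

(* Write A for the schedule that the makespan algorithm returns for the prediction, C for its makespan
   under the prediction, and R for the robust schedule. Choose a rational l with
   lam < l < 2 * lam + 2 and measure predicted job sizes in units of C / l. Jobs of size more than 1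
   stay where A puts them. The small jobs are streamed part by part through R: they fill machine 0,
   then machine 1, and so on. The weight of a machine is its load plus the number of parts of R that
   it has received small jobs from, and the stream moves on as soon as the weight exceeds l + 2. By
   counting the total weight, the stream fits on the m machines. Every machine then has load at most
   l + 2, that is (1 + 2 / l) * C, and its big jobs and pieces of parts of R number at most l + 2;
   each of these costs at most the makespan of R in every scenario.

   As m is not bounded by the input size, the case n <= m is separate: there every job gets its own
   machine, which is optimal for all scenarios at once. The program may contain lam only through l,
   which is why l is rational. *)

theory Submission
  imports Defs
begin

section \<open>Running programs with time bounds\<close>

text \<open>Total correctness with a bound on the number of steps. Since \<open>exec\<close> is
  deterministic, one terminating run within \<open>T\<close> steps is the only run.\<close>

definition runs :: "prog \<Rightarrow> store \<Rightarrow> nat \<Rightarrow> (store \<Rightarrow> bool) \<Rightarrow> bool" where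
  "runs c s T Q \<longleftrightarrow> (\<exists>t s'. exec c s t s' \<and> t \<le> T \<and> Q s')"

lemma runs_mono: "runs c s T Q \<Longrightarrow> T \<le> T' \<Longrightarrow> (\<And>s'. Q s' \<Longrightarrow> Q' s') \<Longrightarrow> runs c s T' Q'"
  unfolding runs_def by (meson le_trans)

lemma runs_Seq:
  assumes "runs c s T Q" and "\<And>s'. Q s' \<Longrightarrow> runs d s' T' R" and "T + T' \<le> T''"
  shows "runs (Seq c d) s T'' R"
proof -
  obtain t s' where c: "exec c s t s'" "t \<le> T" "Q s'" using assms(1) by (auto simp: runs_def)
  obtain t' s'' where d: "exec d s' t' s''" "t' \<le> T'" "R s''"
    using assms(2)[OF c(3)] by (auto simp: runs_def)
  show ?thesis unfolding runs_def
    using exec.Seq[OF c(1) d(1)] c(2) d(2,3) assms(3) by (intro exI[of _ "t + t'"] exI[of _ s'']) simp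
qed

lemma runs_If:
  assumes "eval_expr e s \<noteq> Empty \<Longrightarrow> runs c s T Q" and "eval_expr e s = Empty \<Longrightarrow> runs d s T Q"
    and "T + 1 \<le> T'"
  shows "runs (If e c d) s T' Q"
proof (cases "eval_expr e s = Empty")
  case True
  then obtain t s' where "exec d s t s'" "t \<le> T" "Q s'" using assms(2) by (auto simp: runs_def)
  then show ?thesis unfolding runs_def
    using exec.IfFalse[OF True] assms(3) by (intro exI[of _ "1 + t"] exI[of _ s']) auto
next
  case False
  then obtain t s' where "exec c s t s'" "t \<le> T" "Q s'" using assms(1) by (auto simp: runs_def)
  then show ?thesis unfolding runs_def
    using exec.IfTrue[OF False] assms(3) by (intro exI[of _ "1 + t"] exI[of _ s']) auto
qed

text \<open>The invariant is indexed by the number of finished iterations. As their total number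
  \<open>N\<close> is known in advance, termination and the time bound come together.\<close>

lemma runs_While:
  assumes step: "\<And>i s. i < N \<Longrightarrow> Inv i s \<Longrightarrow> eval_expr e s \<noteq> Empty \<and> runs c s T (Inv (Suc i))"
    and stop: "\<And>s. Inv N s \<Longrightarrow> eval_expr e s = Empty"
    and init: "Inv 0 s" and time: "N * (T + 1) + 1 \<le> T'"
  shows "runs (While e c) s T' (Inv N)"
proof -
  \<comment> \<open>Induction on the number \<open>k\<close> of iterations still to come: each costs
    the body and one test, and the final failing test costs one more step.\<close>
  have "runs (While e c) s (k * (T + 1) + 1) (Inv N)" if "k \<le> N" "Inv (N - k) s" for k s
    using that
  proof (induction k arbitrary: s)
    case 0
    then show ?case using exec.WhileFalse[OF stop] by (force simp: runs_def)
  next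
    case (Suc k)
    then have *: "eval_expr e s \<noteq> Empty" "runs c s T (Inv (Suc (N - Suc k)))"
      using step[of "N - Suc k" s] by auto
    then obtain t s' where c: "exec c s t s'" "t \<le> T" "Inv (N - k) s'"
      using Suc.prems(1) by (auto simp: runs_def Suc_diff_Suc)
    then obtain t' s'' where d: "exec (While e c) s' t' s''" "t' \<le> k * (T + 1) + 1" "Inv N s''"
      using Suc.IH[OF _ c(3)] Suc.prems(1) by (auto simp: runs_def)
    show ?case unfolding runs_def
      using exec.WhileTrue[OF *(1) c(1) d(1)] c(2) d(2,3)
      by (intro exI[of _ "1 + t + t'"] exI[of _ s'']) auto
  qed
  from this[of N s] init show ?thesis using time by (auto intro: runs_mono)
qed

section \<open>Loop-free programs\<close>

fun loop_free :: "prog \<Rightarrow> bool" where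
  "loop_free (Seq c d) \<longleftrightarrow> loop_free c \<and> loop_free d"
| "loop_free (If e c d) \<longleftrightarrow> loop_free c \<and> loop_free d"
| "loop_free (While e c) \<longleftrightarrow> False"
| "loop_free _ \<longleftrightarrow> True"

text \<open>Adding both branches of a conditional gives only an upper bound, which suffices for code
  of constant size.\<close>

fun cost :: "prog \<Rightarrow> nat" where
  "cost (Seq c d) = cost c + cost d"
| "cost (If e c d) = 1 + cost c + cost d"
| "cost _ = 1"

fun final_store :: "prog \<Rightarrow> store \<Rightarrow> store" where
  "final_store (Assign x e) s = s(x := eval_expr e s)"
| "final_store (Seq c d) s = final_store d (final_store c s)"
| "final_store (If e c d) s = (if eval_expr e s = Empty then final_store d s else final_store c s)"
| "final_store _ s = s"

text \<open>Turns a claim about straight-line code into an evaluation of \<open>final_store\<close>,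
  so that simplification acts as symbolic execution.\<close>

lemma runs_loop_free:
  "loop_free c \<Longrightarrow> cost c \<le> T \<Longrightarrow> Q (final_store c s) \<Longrightarrow> runs c s T Q"
proof (induction c arbitrary: s T Q)
  case Skip
  then show ?case using exec.Skip[of s] unfolding runs_def by (intro exI conjI) auto
next
  case (Assign x e)
  then have "1 \<le> T" "Q (s(x := eval_expr e s))" by (simp_all only: cost.simps final_store.simps)
  then show ?case using exec.Assign unfolding runs_def by blast
next
  case (Seq c d)
  have "runs c s (cost c) (\<lambda>s'. s' = final_store c s)"
    using Seq.prems(1) by (intro Seq.IH(1)) auto
  then show ?case
  proof (rule runs_Seq)
    show "runs d s' (cost d) Q" if "s' = final_store c s" for s'
      using Seq.prems that by (intro Seq.IH(2)) auto
  qed (use Seq.prems(2) in simp)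
next
  case (If e c d)
  then show ?case by (auto intro!: runs_If[where T = "cost c + cost d"] split: if_splits)
qed simp

section \<open>Dependence of a run on the variables of the program\<close>

fun expr_vars :: "expr \<Rightarrow> nat set" where
  "expr_vars (Var x) = {x}"
| "expr_vars (Const r) = {}"
| "expr_vars EmptyE = {}"
| "expr_vars (NodeE e f) = expr_vars e \<union> expr_vars f"
| "expr_vars (LeftE e) = expr_vars e"
| "expr_vars (RightE e) = expr_vars e"
| "expr_vars (Add e f) = expr_vars e \<union> expr_vars f"
| "expr_vars (Sub e f) = expr_vars e \<union> expr_vars f"
| "expr_vars (Mul e f) = expr_vars e \<union> expr_vars f"
| "expr_vars (Div e f) = expr_vars e \<union> expr_vars f"
| "expr_vars (Less e f) = expr_vars e \<union> expr_vars f"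
| "expr_vars (IsNum e) = expr_vars e"

fun prog_vars :: "prog \<Rightarrow> nat set" where
  "prog_vars Skip = {}"
| "prog_vars (Assign x e) = insert x (expr_vars e)"
| "prog_vars (Seq c d) = prog_vars c \<union> prog_vars d"
| "prog_vars (If e c d) = expr_vars e \<union> prog_vars c \<union> prog_vars d"
| "prog_vars (While e c) = expr_vars e \<union> prog_vars c"

lemma finite_expr_vars: "finite (expr_vars e)"
  by (induction e) auto

lemma finite_prog_vars: "finite (prog_vars c)"
  by (induction c) (auto simp: finite_expr_vars)

lemma eval_expr_cong: "(\<And>x. x \<in> expr_vars e \<Longrightarrow> s x = r x) \<Longrightarrow> eval_expr e s = eval_expr e r"
  by (induction e) auto

text \<open>The given algorithms are specified only for a start with the input in variable
  \<open>0\<close> and all else \<open>Empty\<close>. Runs from two stores that agree on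
  \<open>V\<close> proceed in lockstep, so such an algorithm can also run while other data is kept
  outside \<open>V\<close>.\<close>

lemma exec_frame:
  assumes "exec c s t s'" "prog_vars c \<subseteq> V" "\<And>x. x \<in> V \<Longrightarrow> s x = r x"
  shows "\<exists>r'. exec c r t r' \<and> (\<forall>x\<in>V. r' x = s' x) \<and> (\<forall>x. x \<notin> V \<longrightarrow> r' x = r x)"
  using assms
proof (induction arbitrary: r rule: exec.induct)
  case (Skip s)
  then show ?case using exec.Skip[of r] by (intro exI[of _ r]) auto
next
  case (Assign x e s)
  have "eval_expr e s = eval_expr e r" using Assign by (intro eval_expr_cong) auto
  then show ?case using Assign
    by (intro exI[of _ "r(x := eval_expr e r)"] conjI exec.Assign) auto
next
  case (Seq c s t s' d u s'')
  obtain r' where r': "exec c r t r'" "\<forall>x\<in>V. r' x = s' x" "\<forall>x. x \<notin> V \<longrightarrow> r' x = r x"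
    using Seq.IH(1)[of r] Seq.prems by auto
  obtain r'' where "exec d r' u r''" "\<forall>x\<in>V. r'' x = s'' x" "\<forall>x. x \<notin> V \<longrightarrow> r'' x = r' x"
    using Seq.IH(2)[of r'] Seq.prems r' by auto
  then show ?case using r' by (intro exI[of _ r'']) (auto intro: exec.Seq)
next
  case (IfTrue e s c t s' d)
  have "eval_expr e s = eval_expr e r" using IfTrue by (intro eval_expr_cong) auto
  moreover obtain r' where "exec c r t r'" "\<forall>x\<in>V. r' x = s' x" "\<forall>x. x \<notin> V \<longrightarrow> r' x = r x"
    using IfTrue.IH[of r] IfTrue.prems by auto
  ultimately show ?case using exec.IfTrue[of e r c t r' d] IfTrue.hyps by metis
next
  case (IfFalse e s d t s' c)
  have "eval_expr e s = eval_expr e r" using IfFalse by (intro eval_expr_cong) auto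
  moreover obtain r' where "exec d r t r'" "\<forall>x\<in>V. r' x = s' x" "\<forall>x. x \<notin> V \<longrightarrow> r' x = r x"
    using IfFalse.IH[of r] IfFalse.prems by auto
  ultimately show ?case using exec.IfFalse[of e r d t r' c] IfFalse.hyps by metis
next
  case (WhileFalse e s c)
  have "eval_expr e s = eval_expr e r" using WhileFalse by (intro eval_expr_cong) auto
  then show ?case using WhileFalse by (intro exI[of _ r] conjI exec.WhileFalse) auto
next
  case (WhileTrue e s c t s' u s'')
  have e: "eval_expr e s = eval_expr e r" using WhileTrue by (intro eval_expr_cong) auto
  obtain r' where r': "exec c r t r'" "\<forall>x\<in>V. r' x = s' x" "\<forall>x. x \<notin> V \<longrightarrow> r' x = r x"
    using WhileTrue.IH(1)[of r] WhileTrue.prems by auto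
  obtain r'' where "exec (While e c) r' u r''" "\<forall>x\<in>V. r'' x = s'' x"
      "\<forall>x. x \<notin> V \<longrightarrow> r'' x = r' x"
    using WhileTrue.IH(2)[of r'] WhileTrue.prems r' by auto
  moreover have "exec (While e c) r (1 + t + u) r''"
    using exec.WhileTrue[of e r c t r' u r''] calculation(1) r'(1) e WhileTrue.hyps(1) by metis
  ultimately show ?case using r'(3) by (intro exI[of _ r'']) auto
qed

lemma runs_computes:
  assumes "computes c x t y" "prog_vars c \<subseteq> {..<b}" "0 < b"
    and "r 0 = x" "\<And>v. 0 < v \<Longrightarrow> v < b \<Longrightarrow> r v = Empty"
  shows "runs c r t (\<lambda>r'. r' 0 = y \<and> (\<forall>v\<ge>b. r' v = r v))"
proof -
  obtain s where s: "exec c ((\<lambda>_. Empty)(0 := x)) t s" "s 0 = y"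
    using assms(1) by (auto simp: computes_def)
  obtain r' where "exec c r t r'" "\<forall>x\<in>{..<b}. r' x = s x" "\<forall>x. x \<notin> {..<b} \<longrightarrow> r' x = r x"
    using exec_frame[OF s(1) assms(2), of r] assms(4,5) by (metis fun_upd_apply gr0I lessThan_iff)
  then show ?thesis using s(2) assms(3) unfolding runs_def
    by (intro exI[of _ t] exI[of _ r']) auto
qed

text \<open>Restores the initial condition of \<open>computes\<close> before a given program is
  called. Variable \<open>0\<close> is spared because it holds the input.\<close>

fun clear :: "nat \<Rightarrow> prog" where
  "clear 0 = Skip"
| "clear (Suc b) = Seq (clear b) (if b = 0 then Skip else Assign b EmptyE)"

lemma runs_clear:
  "runs (clear b) s (Suc b) (\<lambda>s'. s' = (\<lambda>v. if 0 < v \<and> v < b then Empty else s v))"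
proof -
  have "loop_free (clear b)" "cost (clear b) = Suc b"
    "final_store (clear b) s = (\<lambda>v. if 0 < v \<and> v < b then Empty else s v)"
    by (induction b) (auto simp: fun_eq_iff)
  then show ?thesis by (intro runs_loop_free) auto
qed


section \<open>Merging two schedules\<close>

text \<open>The threshold lets one notion serve twice: for nonnegative sizes, \<open>-1\<close>
  gives the full load of a machine and \<open>1\<close> the load of its big jobs.\<close>

definition load_above :: "nat \<Rightarrow> (nat \<Rightarrow> real) \<Rightarrow> (nat \<Rightarrow> nat) \<Rightarrow> real \<Rightarrow> nat \<Rightarrow> real" where
  "load_above n u a \<theta> k = (\<Sum>j | j < n \<and> a j = k \<and> \<theta> < u j. u j)"

text \<open>In a state \<open>(k, w, f)\<close>, machine \<open>k\<close> of weight \<open>w\<close> is being filled and \<open>f\<close> assigns machines to jobs;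
  \<open>x k\<close> is the load of the big jobs on machine \<open>k\<close>.\<close>

fun place ::
    "(nat \<Rightarrow> real) \<Rightarrow> (nat \<Rightarrow> real) \<Rightarrow> (nat \<Rightarrow> nat) \<Rightarrow> real \<Rightarrow> nat \<Rightarrow> nat \<Rightarrow>
     nat \<times> real \<times> (nat \<Rightarrow> nat) \<Rightarrow> nat \<times> real \<times> (nat \<Rightarrow> nat)" where
  "place x u r T i j (k, w, f) =
     (if r j = i \<and> \<not> 1 < u j then
        if T < w then (Suc k, x (Suc k) + 1 + u j, f(j := Suc k)) else (k, w + u j, f(j := k))
      else (k, w, f))"

text \<open>The added \<open>1\<close> charges the current machine for the new part, even if no
  small job of that part ends up there. \<open>place\<close> charges the same unit when a part
  continues on the next machine.\<close>

fun place_part ::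
    "(nat \<Rightarrow> real) \<Rightarrow> (nat \<Rightarrow> real) \<Rightarrow> (nat \<Rightarrow> nat) \<Rightarrow> real \<Rightarrow> nat list \<Rightarrow> nat \<Rightarrow>
     nat \<times> real \<times> (nat \<Rightarrow> nat) \<Rightarrow> nat \<times> real \<times> (nat \<Rightarrow> nat)" where
  "place_part x u r T js i (k, w, f) = fold (place x u r T i) js (k, w + 1, f)"

text \<open>\<open>a\<close> is the schedule for the prediction and \<open>r\<close> the robust one.
  The sizes \<open>u\<close> are the predicted ones in units of \<open>C / l\<close>, hence the load
  bound \<open>l\<close>.\<close>

locale two_schedules =
  fixes m n :: nat and u :: "nat \<Rightarrow> real" and a r :: "nat \<Rightarrow> nat" and l :: real
  assumes m_pos: "0 < m" and u_nonneg: "\<And>j. j < n \<Longrightarrow> 0 \<le> u j"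
    and a_less: "\<And>j. j < n \<Longrightarrow> a j < m" and r_less: "\<And>j. j < n \<Longrightarrow> r j < m"
    and load: "\<And>k. k < m \<Longrightarrow> (\<Sum>j | j < n \<and> a j = k. u j) \<le> l"
begin

abbreviation x :: "nat \<Rightarrow> real" where
  "x \<equiv> load_above n u a 1"

definition small :: "nat set" where
  "small = {j. j < n \<and> \<not> 1 < u j}"

lemma finite_small: "finite small"
  by (simp add: small_def)

lemma x_le: "k < m \<Longrightarrow> x k \<le> l"
  unfolding load_above_def
  by (rule order_trans[OF sum_mono2 load]) (auto simp: u_nonneg)

lemma card_big_le: "real (card {j. j < n \<and> a j = k \<and> 1 < u j}) \<le> x k"
proof -
  have "(\<Sum>j | j < n \<and> a j = k \<and> 1 < u j. 1) \<le> x k"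
    unfolding load_above_def by (rule sum_mono) auto
  then show ?thesis by simp
qed

text \<open>Big and small jobs together are all jobs; grouped by \<open>a\<close>, they fill
  \<open>m\<close> machines of load at most \<open>l\<close>.\<close>

lemma sum_u_le: "(\<Sum>k<m. x k) + sum u small \<le> m * l"
proof -
  have "(\<Sum>k<m. x k) = sum u {j. j < n \<and> 1 < u j}"
  proof -
    have "(\<Sum>k<m. x k) = (\<Sum>k<m. sum u {j \<in> {j. j < n \<and> 1 < u j}. a j = k})"
      unfolding load_above_def by (intro sum.cong refl) auto
    also have "\<dots> = sum u {j. j < n \<and> 1 < u j}"
      by (rule sum.group) (auto simp: a_less)
    finally show ?thesis .
  qed
  then have "(\<Sum>k<m. x k) + sum u small = sum u ({j. j < n \<and> 1 < u j} \<union> small)"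
    by (simp add: sum.union_disjoint small_def disjoint_iff)
  also have "{j. j < n \<and> 1 < u j} \<union> small = {j. j < n}"
    by (auto simp: small_def)
  also have "sum u \<dots> = (\<Sum>k<m. sum u {j \<in> {j. j < n}. a j = k})"
    by (rule sum.group[symmetric]) (auto simp: a_less)
  also have "\<dots> \<le> (\<Sum>k<m. l)"
    using load by (intro sum_mono) auto
  finally show ?thesis by simp
qed

text \<open>\<open>c\<close> parts of the robust schedule have been started, \<open>A\<close> contains the current part (if any), and
  \<open>P\<close> is the set of jobs placed so far. The last clause bounds the total weight.\<close>

definition inv :: "nat \<Rightarrow> nat set \<Rightarrow> nat set \<Rightarrow> nat \<times> real \<times> (nat \<Rightarrow> nat) \<Rightarrow> bool" where
  "inv c A P = (\<lambda>(k, w, f).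
     P \<subseteq> small \<and> k < m \<and> (\<forall>j\<in>P. f j \<le> k) \<and> (\<forall>j. j \<notin> P \<longrightarrow> f j = a j) \<and>
     (\<forall>h<m. x h + sum u {j \<in> P. f j = h} \<le> l + 2) \<and>
     (\<forall>h<m. x h + card (r ` {j \<in> P. f j = h}) \<le> l + 2) \<and>
     x k + sum u {j \<in> P. f j = k} + card (A \<union> r ` {j \<in> P. f j = k}) \<le> w \<and>
     k * (l + 2) + w \<le> (\<Sum>h\<le>k. x h) + sum u P + c + k)"

section \<open>Preservation of the streaming invariant\<close>

lemma inv_init: "inv 0 {} {} (0, x 0, a)"
  using m_pos x_le by (fastforce simp: inv_def)

text \<open>Exchanging the old current part for \<open>i\<close> raises the number of parts charged
  to machine \<open>k\<close> by at most one, which the new weight covers. In the total, the extra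
  unit is paid by \<open>Suc c\<close>.\<close>

lemma inv_start:
  assumes "inv c A P (k, w, f)" "finite A"
  shows "inv (Suc c) {i} P (k, w + 1, f)"
proof -
  let ?B = "r ` {j \<in> P. f j = k}"
  have "finite P" using assms(1) finite_small by (auto simp: inv_def intro: finite_subset)
  then have "card ({i} \<union> ?B) \<le> card ?B + 1" by (simp add: card_insert_if)
  also have "card ?B \<le> card (A \<union> ?B)"
    using \<open>finite P\<close> assms(2) by (intro card_mono) auto
  finally have "real (card ({i} \<union> ?B)) \<le> card (A \<union> ?B) + 1" by linarith
  then show ?thesis using assms(1) by (auto simp: inv_def)
qed

text \<open>If \<open>w \<le> l + 2\<close>, the weight already contains at least one unit for the
  current part, so the load before is at most \<open>l + 1\<close> and a small job adds at most
  \<open>1\<close>; the part of \<open>j\<close> is already counted. Otherwise the machine is fresh: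
  its big load is at most \<open>l\<close>, and it receives one small job from one part.\<close>

lemma inv_put:
  assumes inv: "inv c {i} P (k, w, f)" and w: "w \<le> l + 2 \<or> w = x k + 1 \<and> (\<forall>j\<in>P. f j \<noteq> k)"
    and j: "j \<in> small" "j \<notin> P" "r j = i"
  shows "inv c {i} (insert j P) (k, w + u j, f(j := k))"
proof -
  have fin: "finite P" using inv finite_small by (auto simp: inv_def intro: finite_subset)
  have u: "u j \<le> 1" "0 \<le> u j" using j u_nonneg by (auto simp: small_def)
  define S where "S h = {j \<in> P. f j = h}" for h
  have S: "{j' \<in> insert j P. (f(j := k)) j' = h} = (if h = k then insert j (S h) else S h)" for h
    using j by (auto simp: S_def)
  have [simp]: "finite (S h)" "j \<notin> S h" for h using fin j by (auto simp: S_def)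
  have k: "k < m" and P: "P \<subseteq> small" and f: "\<forall>j\<in>P. f j \<le> k" "\<forall>j. j \<notin> P \<longrightarrow> f j = a j"
    and l1: "\<forall>h<m. x h + sum u (S h) \<le> l + 2" and l2: "\<forall>h<m. x h + card (r ` S h) \<le> l + 2"
    and l3: "x k + sum u (S k) + card (insert i (r ` S k)) \<le> w"
    and l4: "k * (l + 2) + w \<le> (\<Sum>h\<le>k. x h) + sum u P + c + k"
    using inv by (auto simp: inv_def S_def)
  have "1 \<le> real (card (insert i (r ` S k)))"
    using card_gt_0_iff[of "insert i (r ` S k)"] by simp
  moreover have "sum u (S k) \<ge> 0"
    using u_nonneg P by (intro sum_nonneg) (auto simp: S_def small_def)
  moreover have "x k + sum u (S k) + u j \<le> l + 2 \<and> x k + card (insert i (r ` S k)) \<le> l + 2"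
  proof (cases "w \<le> l + 2")
    case True
    then show ?thesis using l3 u calculation by linarith
  next
    case False
    then have "S k = {}" using w by (auto simp: S_def)
    then show ?thesis using u x_le[OF k] by simp
  qed
  ultimately show ?thesis
    unfolding inv_def prod.case S using j k P f l1 l2 l3 l4 fin by (auto simp: S_def[symmetric])
qed

text \<open>Every machine that has been left weighs more than \<open>l + 2\<close>. Machine \<open>m - 1\<close> is never left:
  the total weight is at most \<open>m * l\<close> for the jobs, plus \<open>m\<close> for the parts, plus one for each
  of the \<open>m - 1\<close> times that a part continues on the next machine.\<close>

lemma inv_next:
  assumes inv: "inv c {i} P (k, w, f)" and w: "l + 2 < w" and c: "c \<le> m"
  shows "inv c {i} P (Suc k, x (Suc k) + 1, f)" "\<forall>j\<in>P. f j \<noteq> Suc k"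
proof -
  have k: "k < m" and P: "P \<subseteq> small" and f: "\<forall>j\<in>P. f j \<le> k"
    and l4: "k * (l + 2) + w \<le> (\<Sum>h\<le>k. x h) + sum u P + c + k"
    using inv by (auto simp: inv_def)
  show 1: "\<forall>j\<in>P. f j \<noteq> Suc k" using f by auto
  have "Suc k < m"
  proof (rule ccontr)
    assume "\<not> Suc k < m"
    then have m: "m = Suc k" using k by simp
    have "sum u P \<le> sum u small"
      using P finite_small by (intro sum_mono2) (auto simp: small_def u_nonneg)
    then have "k * (l + 2) + w \<le> m * l + c + k"
      using l4 sum_u_le m by (simp add: lessThan_Suc_atMost)
    then show False using m c w by (simp add: algebra_simps)
  qed
  moreover have 2: "{j \<in> P. f j = Suc k} = {}" using 1 by auto
  \<comment> \<open>In the total, \<open>w\<close> is lowered to \<open>l + 2\<close> for the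
    machine left behind. The new weight is paid by the summand \<open>x (Suc k)\<close> and by the
    unit for one more continued part.\<close>
  ultimately show "inv c {i} P (Suc k, x (Suc k) + 1, f)"
    using inv w by (auto simp: inv_def 2 algebra_simps)
qed

lemma inv_place:
  assumes "inv c {i} P st" "c \<le> m" "j < n" "r j = i \<Longrightarrow> j \<notin> P"
  shows "inv c {i} (P \<union> {j'. j' = j \<and> r j' = i \<and> \<not> 1 < u j'}) (place x u r (l + 2) i j st)"
proof -
  obtain k w f where st: "st = (k, w, f)" by (cases st)
  show ?thesis
  proof (cases "r j = i \<and> \<not> 1 < u j")
    case True
    then have j: "j \<in> small" "j \<notin> P" "r j = i" using assms by (auto simp: small_def)
    have eq: "P \<union> {j'. j' = j \<and> r j' = i \<and> \<not> 1 < u j'} = insert j P" using True by auto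
    show ?thesis
    proof (cases "l + 2 < w")
      case w: True
      note nxt = inv_next[OF assms(1)[unfolded st] w assms(2)]
      show ?thesis using inv_put[OF nxt(1) _ j] nxt(2) True w unfolding eq st by simp
    next
      case False
      then show ?thesis using inv_put[OF assms(1)[unfolded st] _ j] True unfolding eq st by simp
    qed
  next
    case False
    then have "P \<union> {j'. j' = j \<and> r j' = i \<and> \<not> 1 < u j'} = P"
      "place x u r (l + 2) i j st = st" by (auto simp: st)
    then show ?thesis using assms(1) by simp
  qed
qed

lemma inv_fold_place:
  assumes "distinct js" "set js \<subseteq> {..<n}" "c \<le> m" "inv c {i} P st"
    and "\<forall>j\<in>set js. r j = i \<longrightarrow> j \<notin> P"
  shows "inv c {i} (P \<union> {j \<in> set js. r j = i \<and> \<not> 1 < u j}) (fold (place x u r (l + 2) i) js st)"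
  using assms
proof (induction js arbitrary: P st)
  case (Cons j js)
  let ?P = "P \<union> {j'. j' = j \<and> r j' = i \<and> \<not> 1 < u j'}"
  have "inv c {i} ?P (place x u r (l + 2) i j st)"
    using Cons.prems by (intro inv_place) auto
  then have "inv c {i} (?P \<union> {j \<in> set js. r j = i \<and> \<not> 1 < u j})
      (fold (place x u r (l + 2) i) js (place x u r (l + 2) i j st))"
    using Cons.prems(1,2,3,5) by (intro Cons.IH) auto
  also have "?P \<union> {j \<in> set js. r j = i \<and> \<not> 1 < u j} =
      P \<union> {j' \<in> set (j # js). r j' = i \<and> \<not> 1 < u j'}" by auto
  finally show ?case by simp
qed simp

text \<open>\<open>A\<close> is existential because there is no current part before the first round;
  later it is the singleton of the last part.\<close>

lemma inv_fold_place_part: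
  assumes "distinct js" "set js = {..<n}" "c \<le> m"
  shows "\<exists>A. finite A \<and> inv c A {j \<in> small. r j < c}
    (fold (place_part x u r (l + 2) js) [0..<c] (0, x 0, a))"
  using assms(3)
proof (induction c)
  case 0
  then show ?case using inv_init by auto
next
  case (Suc c)
  let ?P = "{j \<in> small. r j < c}"
  obtain k w f where st: "fold (place_part x u r (l + 2) js) [0..<c] (0, x 0, a) = (k, w, f)"
    by (rule prod_cases3)
  then obtain A where *: "finite A" "inv c A ?P (k, w, f)"
    using Suc by auto
  have "inv (Suc c) {c} (?P \<union> {j \<in> set js. r j = c \<and> \<not> 1 < u j})
      (fold (place x u r (l + 2) c) js (k, w + 1, f))"
  proof (rule inv_fold_place[OF assms(1) _ Suc.prems])
    show "inv (Suc c) {c} ?P (k, w + 1, f)" using inv_start[OF *(2,1)] .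
  qed (use assms(2) in auto)
  also have "?P \<union> {j \<in> set js. r j = c \<and> \<not> 1 < u j} = {j \<in> small. r j < Suc c}"
    unfolding assms(2) small_def by (auto simp: less_Suc_eq)
  finally show ?case by (intro exI[of _ "{c}"] conjI) (simp_all add: st)
qed

section \<open>The merged schedule and its loads\<close>

context
  fixes js f
  assumes js: "distinct js" "set js = {..<n}"
    and f: "f = snd (snd (fold (place_part x u r (l + 2) js) [0..<m] (0, x 0, a)))"
begin

lemma merged_inv:
  shows "j < n \<Longrightarrow> f j < m"
    and "j \<notin> small \<Longrightarrow> f j = a j"
    and "h < m \<Longrightarrow> x h + sum u {j \<in> small. f j = h} \<le> l + 2"
    and "h < m \<Longrightarrow> x h + card (r ` {j \<in> small. f j = h}) \<le> l + 2"
proof -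
  obtain k w f' where st: "fold (place_part x u r (l + 2) js) [0..<m] (0, x 0, a) = (k, w, f')"
    by (metis prod_cases3)
  then have [simp]: "f' = f" using f by simp
  have [simp]: "{j \<in> small. r j < m} = small" using r_less by (auto simp: small_def)
  obtain A where "inv m A small (k, w, f)"
    using inv_fold_place_part[OF js, of m] st by auto
  then have k: "k < m" "\<forall>j\<in>small. f j \<le> k" and nsmall: "\<forall>j. j \<notin> small \<longrightarrow> f j = a j"
    and le: "\<forall>h<m. x h + sum u {j \<in> small. f j = h} \<le> l + 2"
      "\<forall>h<m. x h + card (r ` {j \<in> small. f j = h}) \<le> l + 2"
    by (auto simp: inv_def)
  show "j < n \<Longrightarrow> f j < m" using k nsmall a_less by (cases "j \<in> small") auto
  show "j \<notin> small \<Longrightarrow> f j = a j" using nsmall by simp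
  show "h < m \<Longrightarrow> x h + sum u {j \<in> small. f j = h} \<le> l + 2"
    "h < m \<Longrightarrow> x h + card (r ` {j \<in> small. f j = h}) \<le> l + 2" using le by auto
qed

text \<open>The sizes \<open>q\<close> are arbitrary, since the split into big jobs, still placed by
  \<open>a\<close>, and streamed jobs is used for the prediction and for every scenario.\<close>

lemma sum_merged:
  "(\<Sum>j | j < n \<and> f j = h. q j) =
    (\<Sum>j | j < n \<and> a j = h \<and> 1 < u j. q j) + (\<Sum>j\<in>{j \<in> small. f j = h}. q j)"
proof -
  have "{j. j < n \<and> f j = h} = {j. j < n \<and> a j = h \<and> 1 < u j} \<union> {j \<in> small. f j = h}"
    using merged_inv(2) by (auto simp: small_def)
  then show ?thesis
    by (simp only:, subst sum.union_disjoint) (auto simp: small_def)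
qed

lemma merged_load: "h < m \<Longrightarrow> (\<Sum>j | j < n \<and> f j = h. u j) \<le> l + 2"
  using merged_inv(3)[of h] by (simp add: sum_merged load_above_def)

text \<open>A big job, or the small jobs on \<open>h\<close> from one part of \<open>r\<close>, form
  a subset of a part of \<open>r\<close> and so cost at most \<open>R\<close>. There are at most
  \<open>x h\<close> big jobs, as each has size above \<open>1\<close>, and the invariant bounds
  \<open>x h\<close> plus the number of parts by \<open>l + 2\<close>.\<close>

lemma merged_robust:
  assumes q: "\<And>j. j < n \<Longrightarrow> 0 \<le> q j"
    and R: "\<And>i. i < m \<Longrightarrow> (\<Sum>j | j < n \<and> r j = i. q j) \<le> R" and h: "h < m"
  shows "(\<Sum>j | j < n \<and> f j = h. q j) \<le> (l + 2) * R"
proof -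
  have R0: "0 \<le> R" using R[OF h] sum_nonneg[of "{j. j < n \<and> r j = h}" q] q by auto
  have part: "sum q B \<le> R" if "B \<subseteq> {j. j < n \<and> r j = i}" "i < m" for B i
    using sum_mono2[OF _ that(1), of q] q R[OF that(2)] by fastforce
  let ?Q = "{j. j < n \<and> a j = h \<and> 1 < u j}" and ?S = "{j \<in> small. f j = h}"
  have "sum q ?Q \<le> (\<Sum>j\<in>?Q. R)"
    using part[of "{j}" "r j" for j] r_less by (intro sum_mono) simp
  then have "sum q ?Q \<le> card ?Q * R" by simp
  moreover have "sum q ?S = (\<Sum>i\<in>r ` ?S. sum q {j \<in> ?S. r j = i})"
    using finite_small by (intro sum.group[symmetric]) auto
  moreover have "\<dots> \<le> (\<Sum>i\<in>r ` ?S. R)"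
    using r_less by (intro sum_mono part) (auto simp: small_def)
  moreover have "\<dots> = card (r ` ?S) * R" by simp
  ultimately have "(\<Sum>j | j < n \<and> f j = h. q j) \<le> (card ?Q + card (r ` ?S)) * R"
    by (simp add: sum_merged algebra_simps)
  also have "\<dots> \<le> (l + 2) * R"
    using card_big_le[of h] merged_inv(4)[OF h] R0 by (intro mult_right_mono) auto
  finally show ?thesis .
qed

end

end


section \<open>The program\<close>

abbreviation seq_prog (infixr ";;" 60) where
  "c ;; d \<equiv> Seq c d"

abbreviation assign_prog (infix "::=" 62) where
  "x ::= e \<equiv> Assign x e"

lemma truth_eq_Empty [simp]: "truth b = Empty \<longleftrightarrow> \<not> b"
  by (simp add: truth_def)

lemma enc_list_simps [simp]:
  "enc_list [] = Empty" "enc_list (y # ys) = Node (Num y) (enc_list ys)"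
  by (simp_all add: enc_list_def)

lemma enc_list_eq_Empty [simp]: "enc_list ys = Empty \<longleftrightarrow> ys = []"
  by (cases ys) auto

lemma data_size_enc_list: "data_size (enc_list ys) = 2 * length ys + 1"
  by (induction ys) auto

text \<open>Each job is a record of its size, its machine in the robust schedule, and its current machine.\<close>

definition records ::
    "(nat \<Rightarrow> real) \<Rightarrow> (nat \<Rightarrow> nat) \<Rightarrow> (nat \<Rightarrow> nat) \<Rightarrow> nat list \<Rightarrow> data" where
  "records p r f js =
     foldr (\<lambda>j. Node (Node (Num (p j)) (Node (Num (real (r j))) (Num (real (f j)))))) js Empty"

lemma records_simps [simp]:
  "records p r f [] = Empty"
  "records p r f (j # js) =
     Node (Node (Num (p j)) (Node (Num (real (r j))) (Num (real (f j))))) (records p r f js)"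
  by (simp_all add: records_def)

lemma records_eq_Empty [simp]: "records p r f js = Empty \<longleftrightarrow> js = []"
  by (cases js) auto

lemma records_cong: "(\<And>j. j \<in> set js \<Longrightarrow> f j = g j) \<Longrightarrow> records p r f js = records p r g js"
  by (induction js) auto

text \<open>Variables of \<open>merge_prog\<close>: 1 holds \<open>m\<close>, 2 to 4 the sizes and the two given assignments, 5 the
  records, 6 the unit of size, 7 the threshold of \<^const>\<open>load_above\<close>, 8 a machine, 9 a list of loads,
  10 the maximal load and later the current part, 11 a list of records, 12 a load or weight.\<close>

definition zip_body :: prog where
  "zip_body =
     5 ::= NodeE (NodeE (LeftE (Var 2)) (NodeE (LeftE (Var 4)) (LeftE (Var 3)))) (Var 5) ;;
     2 ::= RightE (Var 2) ;; 3 ::= RightE (Var 3) ;; 4 ::= RightE (Var 4)"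

definition zip_prog :: prog where
  "zip_prog = 5 ::= EmptyE ;; While (Var 2) zip_body"

text \<open>Prepending the records one by one reverses the job order, hence
  \<open>rev [0..<n]\<close>. The bounds on the merged schedule hold for any order, and
  \<open>extract_prog\<close> reverses the list back.\<close>

lemma runs_zip_prog:
  assumes "s 2 = enc_list p" "s 3 = enc_list (map real a)" "s 4 = enc_list (map real r)"
    and "length p = n" "length a = n" "length r = n"
  shows "runs zip_prog s (5 * n + 2)
    (\<lambda>s'. s' 1 = s 1 \<and> s' 5 = records ((!) p) ((!) r) ((!) a) (rev [0..<n]))"
  unfolding zip_prog_def
proof (rule runs_Seq)
  let ?Inv = "\<lambda>i (s' :: store). s' 1 = s 1 \<and> s' 2 = enc_list (drop i p) \<and>
    s' 3 = enc_list (map real (drop i a)) \<and> s' 4 = enc_list (map real (drop i r)) \<and>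
    s' 5 = records ((!) p) ((!) r) ((!) a) (rev [0..<i])"
  show "runs (5 ::= EmptyE) s 1 (?Inv 0)"
    using assms by (intro runs_loop_free) auto
  fix s' assume "?Inv 0 s'"
  have "runs (While (Var 2) zip_body) s' (5 * n + 1) (?Inv n)"
  proof (rule runs_While[where T = 4 and N = n and Inv = ?Inv])
    fix i s' assume i: "i < n" and inv: "?Inv i s'"
    have "drop i p = p ! i # drop (Suc i) p" "drop i a = a ! i # drop (Suc i) a"
      "drop i r = r ! i # drop (Suc i) r"
      using i assms by (simp_all add: Cons_nth_drop_Suc)
    then show "eval_expr (Var 2) s' \<noteq> Empty \<and> runs zip_body s' 4 (?Inv (Suc i))"
      using inv by (auto intro!: runs_loop_free simp: zip_body_def)
  qed (use \<open>?Inv 0 s'\<close> assms in auto)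
  then show "runs (While (Var 2) zip_body) s' (5 * n + 1)
    (\<lambda>s'. s' 1 = s 1 \<and> s' 5 = records ((!) p) ((!) r) ((!) a) (rev [0..<n]))"
    by (rule runs_mono) auto
qed simp

section \<open>Computing the loads of the machines\<close>

definition sum_body :: prog where
  "sum_body =
     If (Less (Var 7) (Div (LeftE (LeftE (Var 11))) (Var 6)))
       (If (Less (RightE (RightE (LeftE (Var 11)))) (Var 8)) Skip
         (If (Less (Var 8) (RightE (RightE (LeftE (Var 11))))) Skip
           (12 ::= Add (Var 12) (Div (LeftE (LeftE (Var 11))) (Var 6)))))
       Skip ;;
     11 ::= RightE (Var 11)"

definition sum_prog :: prog where
  "sum_prog = (11 ::= Var 5 ;; 12 ::= Const 0) ;; While (Var 11) sum_body"

lemma runs_sum_prog: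
  assumes "distinct js" "set js = {..<n}"
    and s: "s 5 = records p r a js" "num (s 6) = D" "num (s 7) = \<theta>" "num (s 8) = real k"
  shows "runs sum_prog s (9 * n + 3)
    (\<lambda>s'. s' 12 = Num (load_above n (\<lambda>j. p j / D) a \<theta> k) \<and> (\<forall>v. v \<notin> {11, 12} \<longrightarrow> s' v = s v))"
  unfolding sum_prog_def
proof -
  have len: "length js = n" using assms(1,2) distinct_card[of js] by simp
  \<comment> \<open>The contribution of one job. The two nested strict comparisons in
    \<open>sum_body\<close> both fail exactly when \<open>a j = k\<close>.\<close>
  define g where "g j = (if a j = k \<and> \<theta> < p j / D then p j / D else 0)" for j
  let ?Inv = "\<lambda>i (s' :: store). s' 11 = records p r a (drop i js) \<and>
    s' 12 = Num (sum_list (map g (take i js))) \<and> (\<forall>v. v \<notin> {11, 12} \<longrightarrow> s' v = s v)"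
  have "sum_list (map g js) = sum g {..<n}"
    using assms(1,2) by (simp add: sum_list_distinct_conv_sum_set)
  also have "\<dots> = load_above n (\<lambda>j. p j / D) a \<theta> k"
    unfolding g_def load_above_def by (simp add: sum.inter_filter[symmetric] conj_commute)
  finally have total: "sum_list (map g js) = load_above n (\<lambda>j. p j / D) a \<theta> k" .
  show "runs ((11 ::= Var 5 ;; 12 ::= Const 0) ;; While (Var 11) sum_body) s (9 * n + 3) (\<lambda>s'.
        s' 12 = Num (load_above n (\<lambda>j. p j / D) a \<theta> k) \<and> (\<forall>v. v \<notin> {11, 12} \<longrightarrow> s' v = s v))"
  proof (rule runs_Seq)
    show "runs (11 ::= Var 5 ;; 12 ::= Const 0) s 2 (?Inv 0)"
      using s by (intro runs_loop_free) auto
    fix s' assume inv0: "?Inv 0 s'"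
    have "runs (While (Var 11) sum_body) s' (9 * n + 1) (?Inv n)"
    proof (rule runs_While[where T = 8 and N = n and Inv = ?Inv])
      fix i s' assume i: "i < n" and inv: "?Inv i s'"
      have "drop i js = js ! i # drop (Suc i) js" "take (Suc i) js = take i js @ [js ! i]"
        using i len by (simp_all add: Cons_nth_drop_Suc take_Suc_conv_app_nth)
      then show "eval_expr (Var 11) s' \<noteq> Empty \<and> runs sum_body s' 8 (?Inv (Suc i))"
        using inv s by (intro conjI runs_loop_free) (auto simp: g_def sum_body_def)
    qed (use inv0 len in auto)
    then show "runs (While (Var 11) sum_body) s' (9 * n + 1) (\<lambda>s'.
        s' 12 = Num (load_above n (\<lambda>j. p j / D) a \<theta> k) \<and> (\<forall>v. v \<notin> {11, 12} \<longrightarrow> s' v = s v))"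
      by (rule runs_mono) (auto simp: len total)
  qed simp
qed

text \<open>Machines are visited from the last down to \<open>0\<close>, so that prepending lists
  the loads in increasing order of machines.\<close>

definition loads_body :: prog where
  "loads_body =
     8 ::= Sub (Var 8) (Const 1) ;;
     sum_prog ;;
     9 ::= NodeE (Var 12) (Var 9) ;;
     If (Less (Var 10) (Var 12)) (10 ::= Var 12) Skip"

definition loads_prog :: prog where
  "loads_prog =
     (8 ::= Var 1 ;; 9 ::= EmptyE ;; 10 ::= Const 0) ;; While (Less (Const 0) (Var 8)) loads_body"

lemma runs_loads_prog:
  assumes "distinct js" "set js = {..<n}"
    and s: "s 1 = Num (real m)" "s 5 = records p r a js" "num (s 6) = D" "num (s 7) = \<theta>"
  shows "runs loads_prog s (m * (9 * n + 9) + 4)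
    (\<lambda>s'. s' 9 = enc_list (map (load_above n (\<lambda>j. p j / D) a \<theta>) [0..<m]) \<and>
       num (s' 10) = Max (insert 0 (load_above n (\<lambda>j. p j / D) a \<theta> ` {..<m})) \<and>
       (\<forall>v<8. s' v = s v))"
  unfolding loads_prog_def
proof -
  let ?x = "load_above n (\<lambda>j. p j / D) a \<theta>"
  \<comment> \<open>The inserted \<open>0\<close> is the initial value of variable \<open>10\<close>
    and makes the maximum meaningful before the first machine.\<close>
  define M where "M i = Max (insert 0 (?x ` {m - i..<m}))" for i
  let ?Inv = "\<lambda>i (s' :: store). s' 8 = Num (real (m - i)) \<and>
    s' 9 = enc_list (map ?x [m - i..<m]) \<and> num (s' 10) = M i \<and> (\<forall>v<8. s' v = s v)"
  let ?init = "8 ::= Var 1 ;; 9 ::= EmptyE ;; 10 ::= Const 0"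
  let ?loop = "While (Less (Const 0) (Var 8)) loads_body"
  have loop: "runs ?loop s' (m * (9 * n + 9) + 1) (?Inv m)" if "?Inv 0 s'" for s'
  proof (rule runs_While[where T = "9 * n + 8" and N = m and Inv = ?Inv])
    fix i s' assume i: "i < m" and inv: "?Inv i s'"
    let ?k = "m - Suc i"
    have k: "m - i = Suc ?k" "[?k..<m] = ?k # [m - i..<m]" "{?k..<m} = insert ?k {m - i..<m}"
      using i by (simp_all add: upt_conv_Cons Suc_diff_Suc) auto
    have "runs loads_body s' (9 * n + 8) (?Inv (Suc i))"
      unfolding loads_body_def
    proof (rule runs_Seq)
      show "runs (8 ::= Sub (Var 8) (Const 1)) s' 1 (\<lambda>s2. s2 = s'(8 := Num (real ?k)))"
        using inv k(1) by (intro runs_loop_free) auto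
      fix s2 assume s2: "s2 = s'(8 := Num (real ?k))"
      show "runs (sum_prog ;; 9 ::= NodeE (Var 12) (Var 9) ;;
          If (Less (Var 10) (Var 12)) (10 ::= Var 12) Skip) s2 (9 * n + 7) (?Inv (Suc i))"
      proof (rule runs_Seq)
        show "runs sum_prog s2 (9 * n + 3)
          (\<lambda>s'. s' 12 = Num (?x ?k) \<and> (\<forall>v. v \<notin> {11, 12} \<longrightarrow> s' v = s2 v))"
          using s s2 inv by (intro runs_sum_prog[OF assms(1,2)]) auto
        fix s3 assume s3: "s3 12 = Num (?x ?k) \<and> (\<forall>v. v \<notin> {11, 12} \<longrightarrow> s3 v = s2 v)"
        have "M (Suc i) = max (?x ?k) (M i)"
          unfolding M_def k(3) image_insert by (subst insert_commute, subst Max_insert) auto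
        then show "runs (9 ::= NodeE (Var 12) (Var 9) ;;
          If (Less (Var 10) (Var 12)) (10 ::= Var 12) Skip) s3 4 (?Inv (Suc i))"
          using s2 s3 inv by (intro runs_loop_free) (auto simp: k(2))
      qed simp
    qed simp
    then show "eval_expr (Less (Const 0) (Var 8)) s' \<noteq> Empty \<and> runs loads_body s' (9 * n + 8) (?Inv (Suc i))"
      using inv i by simp
  qed (use that in \<open>auto simp: truth_def\<close>)
  have "runs (?init ;; ?loop) s (m * (9 * n + 9) + 4) (?Inv m)"
    by (rule runs_Seq[OF _ loop], rule runs_loop_free[where T = 3]) (use s in \<open>auto simp: M_def\<close>)
  then show "runs (?init ;; ?loop) s (m * (9 * n + 9) + 4)
    (\<lambda>s'. s' 9 = enc_list (map ?x [0..<m]) \<and>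
       num (s' 10) = Max (insert 0 (?x ` {..<m})) \<and> (\<forall>v<8. s' v = s v))"
    by (rule runs_mono) (auto simp: atLeast0LessThan M_def)
qed


section \<open>Streaming the small jobs\<close>

definition place_body :: "rat \<Rightarrow> prog" where
  "place_body T =
     (let p = LeftE (LeftE (Var 5)); r = LeftE (RightE (LeftE (Var 5)));
          copy = 11 ::= NodeE (LeftE (Var 5)) (Var 11)
      in If (Less r (Var 10)) copy (If (Less (Var 10) r) copy (If (Less (Const 1) (Div p (Var 6))) copy
           (If (Less (Const T) (Var 12))
              (8 ::= Add (Var 8) (Const 1) ;; 9 ::= RightE (Var 9) ;; 12 ::= Add (LeftE (Var 9)) (Const 1))
              Skip ;;
            12 ::= Add (Var 12) (Div p (Var 6)) ;;
            11 ::= NodeE (NodeE p (NodeE r (Var 8))) (Var 11)))) ;;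
         5 ::= RightE (Var 5))"

text \<open>One pass moves the records from variable \<open>5\<close> to variable \<open>11\<close>
  in reverse; the second loop reverses them back, so every part sees the jobs in the same
  order.\<close>

definition part_body :: "rat \<Rightarrow> prog" where
  "part_body T =
     (12 ::= Add (Var 12) (Const 1) ;; 11 ::= EmptyE) ;;
     While (Var 5) (place_body T) ;;
     While (Var 11) (5 ::= NodeE (LeftE (Var 11)) (Var 5) ;; 11 ::= RightE (Var 11)) ;;
     10 ::= Add (Var 10) (Const 1)"

definition place_prog :: "rat \<Rightarrow> prog" where
  "place_prog T =
     (8 ::= Const 0 ;; 10 ::= Const 0 ;; 12 ::= LeftE (Var 9)) ;;
     While (Less (Var 10) (Var 1)) (part_body T)"

text \<open>The assignment \<open>f\<close> is absent because it is stored in the records, which are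
  split between variables \<open>5\<close> and \<open>11\<close> during a pass.\<close>

definition encodes_state ::
    "nat \<Rightarrow> (nat \<Rightarrow> real) \<Rightarrow> real \<Rightarrow> nat \<Rightarrow> nat \<times> real \<times> (nat \<Rightarrow> nat) \<Rightarrow> store \<Rightarrow> bool" where
  "encodes_state m x D i = (\<lambda>(k, w, f) s. s 1 = Num (real m) \<and> num (s 6) = D \<and>
     s 8 = Num (real k) \<and> s 9 = enc_list (map x [k..<m]) \<and> s 10 = Num (real i) \<and> num (s 12) = w)"

lemma right_enc_list_upt: "right (enc_list (map x [k..<m])) = enc_list (map x [Suc k..<m])"
  by (cases "k < m") (simp_all add: upt_conv_Cons)

text \<open>Reading past the last machine yields \<open>Empty\<close>, which counts as
  \<open>0\<close>. With \<open>x k = 0\<close> there, the program follows \<open>place\<close>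
  without any appeal to the bound on \<open>k\<close>.\<close>

lemma left_enc_list_upt:
  "(m \<le> k \<Longrightarrow> x k = 0) \<Longrightarrow> num (left (enc_list (map x [k..<m]))) = x k"
  by (cases "k < m") (simp_all add: upt_conv_Cons)

lemma runs_place_body:
  assumes x: "\<And>k. m \<le> k \<Longrightarrow> x k = 0" and st: "encodes_state m x D i (k, w, f) s"
    and s: "s 5 = records p r f (j # js)" "s 11 = records p r f js'" and j: "j \<notin> set js" "j \<notin> set js'"
    and st': "place x (\<lambda>j. p j / D) r (of_rat T) i j (k, w, f) = (k', w', f')"
  shows "runs (place_body T) s 15 (\<lambda>s'. encodes_state m x D i (k', w', f') s' \<and>
    s' 5 = records p r f' js \<and> s' 11 = records p r f' (j # js'))"
proof -
  \<comment> \<open>Only the value at \<open>j\<close> can change, and \<open>j\<close> occurs in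
    neither list.\<close>
  have "records p r f' js = records p r f js" "records p r f' js' = records p r f js'"
    using st' j by (auto intro!: records_cong split: if_splits)
  then show ?thesis
    using st s st' x unfolding place_body_def Let_def
    by (intro runs_loop_free)
      (auto simp: encodes_state_def right_enc_list_upt left_enc_list_upt split: if_splits)
qed

lemma runs_reverse:
  assumes "s 5 = Empty" "s 11 = records p r f js"
  shows "runs (While (Var 11) (5 ::= NodeE (LeftE (Var 11)) (Var 5) ;; 11 ::= RightE (Var 11))) s
    (3 * length js + 1)
    (\<lambda>s'. s' 5 = records p r f (rev js) \<and> (\<forall>v. v \<notin> {5, 11} \<longrightarrow> s' v = s v))"
proof -
  let ?Inv = "\<lambda>i (s' :: store). s' 5 = records p r f (rev (take i js)) \<and>
    s' 11 = records p r f (drop i js) \<and> (\<forall>v. v \<notin> {5, 11} \<longrightarrow> s' v = s v)"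
  have "runs (While (Var 11) (5 ::= NodeE (LeftE (Var 11)) (Var 5) ;; 11 ::= RightE (Var 11))) s
    (3 * length js + 1) (?Inv (length js))"
  proof (rule runs_While[where T = 2 and Inv = ?Inv])
    fix i s' assume i: "i < length js" and inv: "?Inv i s'"
    have "drop i js = js ! i # drop (Suc i) js" "take (Suc i) js = take i js @ [js ! i]"
      using i by (simp_all add: Cons_nth_drop_Suc take_Suc_conv_app_nth)
    then show "eval_expr (Var 11) s' \<noteq> Empty \<and>
        runs (5 ::= NodeE (LeftE (Var 11)) (Var 5) ;; 11 ::= RightE (Var 11)) s' 2 (?Inv (Suc i))"
      using inv by (intro conjI runs_loop_free) auto
  qed (use assms in auto)
  then show ?thesis by (rule runs_mono) auto
qed

lemma runs_part_body:
  assumes x: "\<And>k. m \<le> k \<Longrightarrow> x k = 0" and js: "distinct js" "length js = n"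
    and st: "encodes_state m x D i (k, w, f) s" and s: "s 5 = records p r f js"
    and st': "place_part x (\<lambda>j. p j / D) r (of_rat T) js i (k, w, f) = (k', w', f')"
  shows "runs (part_body T) s (19 * n + 5)
    (\<lambda>s'. encodes_state m x D (Suc i) (k', w', f') s' \<and> s' 5 = records p r f' js)"
  unfolding part_body_def
proof (rule runs_Seq)
  let ?st = "\<lambda>t. fold (place x (\<lambda>j. p j / D) r (of_rat T) i) (take t js) (k, w + 1, f)"
  let ?Inv = "\<lambda>t s'. encodes_state m x D i (?st t) s' \<and>
    s' 5 = records p r (snd (snd (?st t))) (drop t js) \<and>
    s' 11 = records p r (snd (snd (?st t))) (rev (take t js))"
  let ?reverse = "While (Var 11) (5 ::= NodeE (LeftE (Var 11)) (Var 5) ;; 11 ::= RightE (Var 11))"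
  show "runs (12 ::= Add (Var 12) (Const 1) ;; 11 ::= EmptyE) s 2 (?Inv 0)"
    using st s by (intro runs_loop_free) (auto simp: encodes_state_def)
  fix s2 :: store assume s2: "?Inv 0 s2"
  show "runs (While (Var 5) (place_body T) ;; ?reverse ;; 10 ::= Add (Var 10) (Const 1)) s2 (19 * n + 3)
    (\<lambda>s'. encodes_state m x D (Suc i) (k', w', f') s' \<and> s' 5 = records p r f' js)"
  proof (rule runs_Seq)
    show "runs (While (Var 5) (place_body T)) s2 (16 * n + 1) (?Inv n)"
    proof (rule runs_While[where T = 15 and Inv = ?Inv])
      fix t s' assume t: "t < n" and inv: "?Inv t s'"
      obtain k1 w1 f1 where 1: "?st t = (k1, w1, f1)" by (rule prod_cases3)
      obtain k2 w2 f2 where 2: "?st (Suc t) = (k2, w2, f2)" by (rule prod_cases3)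
      have d: "drop t js = js ! t # drop (Suc t) js" "take (Suc t) js = take t js @ [js ! t]"
        using t js by (simp_all add: Cons_nth_drop_Suc take_Suc_conv_app_nth)
      have "distinct (take t js @ js ! t # drop (Suc t) js)"
        using js(1) by (simp flip: d(1))
      moreover have "place x (\<lambda>j. p j / D) r (of_rat T) i (js ! t) (k1, w1, f1) = (k2, w2, f2)"
        using 2 unfolding d(2) fold_append by (simp only: o_apply 1 fold.simps id_apply)
      ultimately have "runs (place_body T) s' 15 (\<lambda>s'. encodes_state m x D i (k2, w2, f2) s' \<and>
          s' 5 = records p r f2 (drop (Suc t) js) \<and> s' 11 = records p r f2 (js ! t # rev (take t js)))"
        using x inv unfolding 1 d(1) by (intro runs_place_body) auto
      then have "runs (place_body T) s' 15 (?Inv (Suc t))"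
        unfolding 2 by (simp add: d(2))
      moreover have "eval_expr (Var 5) s' \<noteq> Empty" using inv t js by simp
      ultimately show "eval_expr (Var 5) s' \<noteq> Empty \<and> runs (place_body T) s' 15 (?Inv (Suc t))"
        by simp
    qed (use s2 js in auto)
    fix s3 :: store assume "?Inv n s3"
    then have s3: "encodes_state m x D i (k', w', f') s3" "s3 5 = Empty"
      "s3 11 = records p r f' (rev js)"
      using js st' by auto
    show "runs (?reverse ;; 10 ::= Add (Var 10) (Const 1)) s3 (3 * n + 2)
      (\<lambda>s'. encodes_state m x D (Suc i) (k', w', f') s' \<and> s' 5 = records p r f' js)"
    proof (rule runs_Seq)
      show "runs ?reverse s3 (3 * n + 1)
        (\<lambda>s'. s' 5 = records p r f' js \<and> (\<forall>v. v \<notin> {5, 11} \<longrightarrow> s' v = s3 v))"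
        using runs_reverse[OF s3(2,3)] js(2) by simp
    qed (use s3(1) in \<open>auto intro!: runs_loop_free[where T = 1] simp: encodes_state_def\<close>)
  qed simp
qed simp

lemma runs_place_prog:
  assumes x: "\<And>k. m \<le> k \<Longrightarrow> x k = 0" and js: "distinct js" "length js = n"
    and s: "s 1 = Num (real m)" "num (s 6) = D" "s 9 = enc_list (map x [0..<m])"
      "s 5 = records p r a js"
  shows "runs (place_prog T) s (m * (19 * n + 6) + 4) (\<lambda>s'. s' 5 = records p r
    (snd (snd (fold (place_part x (\<lambda>j. p j / D) r (of_rat T) js) [0..<m] (0, x 0, a)))) js)"
  unfolding place_prog_def
proof (rule runs_Seq)
  let ?st = "\<lambda>i. fold (place_part x (\<lambda>j. p j / D) r (of_rat T) js) [0..<i] (0, x 0, a)"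
  let ?Inv = "\<lambda>i s'. encodes_state m x D i (?st i) s' \<and> s' 5 = records p r (snd (snd (?st i))) js"
  show "runs (8 ::= Const 0 ;; 10 ::= Const 0 ;; 12 ::= LeftE (Var 9)) s 3 (?Inv 0)"
    using s x by (intro runs_loop_free) (auto simp: encodes_state_def left_enc_list_upt)
  fix s2 :: store assume s2: "?Inv 0 s2"
  have "runs (While (Less (Var 10) (Var 1)) (part_body T)) s2 (m * (19 * n + 6) + 1) (?Inv m)"
  proof (rule runs_While[where T = "19 * n + 5" and Inv = ?Inv])
    fix i s' assume i: "i < m" and inv: "?Inv i s'"
    obtain k1 w1 f1 where 1: "?st i = (k1, w1, f1)" by (rule prod_cases3)
    obtain k2 w2 f2 where 2: "?st (Suc i) = (k2, w2, f2)" by (rule prod_cases3)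
    have "place_part x (\<lambda>j. p j / D) r (of_rat T) js i (k1, w1, f1) = (k2, w2, f2)"
      using 1 2 by simp
    then have "runs (part_body T) s' (19 * n + 5) (?Inv (Suc i))"
      using inv unfolding 1 2 snd_conv by (intro runs_part_body[OF x js]) auto
    then show "eval_expr (Less (Var 10) (Var 1)) s' \<noteq> Empty \<and>
        runs (part_body T) s' (19 * n + 5) (?Inv (Suc i))"
      using inv i unfolding 1 by (simp add: encodes_state_def)
  next
    show "eval_expr (Less (Var 10) (Var 1)) s' = Empty" if "?Inv m s'" for s'
      using that by (auto simp: encodes_state_def split: prod.splits)
  qed (use s2 in simp_all)
  then show "runs (While (Less (Var 10) (Var 1)) (part_body T)) s2 (m * (19 * n + 6) + 1)
      (\<lambda>s'. s' 5 = records p r (snd (snd (?st m))) js)"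
    by (rule runs_mono) auto
qed simp

definition extract_prog :: prog where
  "extract_prog =
     0 ::= EmptyE ;;
     While (Var 5) (0 ::= NodeE (RightE (RightE (LeftE (Var 5)))) (Var 0) ;; 5 ::= RightE (Var 5))"

lemma runs_extract_prog:
  assumes "s 5 = records p r f js"
  shows "runs extract_prog s (3 * length js + 2)
    (\<lambda>s'. s' 0 = enc_list (map (\<lambda>j. real (f j)) (rev js)))"
  unfolding extract_prog_def
proof (rule runs_Seq)
  let ?body = "0 ::= NodeE (RightE (RightE (LeftE (Var 5)))) (Var 0) ;; 5 ::= RightE (Var 5)"
  let ?Inv = "\<lambda>i (s' :: store). s' 0 = enc_list (map (\<lambda>j. real (f j)) (rev (take i js))) \<and>
    s' 5 = records p r f (drop i js)"
  show "runs (0 ::= EmptyE) s 1 (?Inv 0)"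
    using assms by (intro runs_loop_free) auto
  fix s2 :: store assume s2: "?Inv 0 s2"
  have "runs (While (Var 5) ?body) s2 (3 * length js + 1) (?Inv (length js))"
  proof (rule runs_While[where T = 2 and Inv = ?Inv])
    fix i s' assume i: "i < length js" and inv: "?Inv i s'"
    have "drop i js = js ! i # drop (Suc i) js" "take (Suc i) js = take i js @ [js ! i]"
      using i by (simp_all add: Cons_nth_drop_Suc take_Suc_conv_app_nth)
    then show "eval_expr (Var 5) s' \<noteq> Empty \<and> runs ?body s' 2 (?Inv (Suc i))"
      using inv by (intro conjI runs_loop_free) auto
  qed (use s2 in auto)
  then show "runs (While (Var 5) ?body) s2 (3 * length js + 1)
      (\<lambda>s'. s' 0 = enc_list (map (\<lambda>j. real (f j)) (rev js)))"
    by (rule runs_mono) auto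
qed simp

text \<open>The first pass of \<open>loads_prog\<close>, with unit \<open>1\<close> and threshold
  \<open>-1\<close>, finds the maximal load \<open>C\<close>. The second, with unit
  \<open>C / l\<close> and threshold \<open>1\<close>, finds the loads of the big jobs.\<close>

definition merge_prog :: "rat \<Rightarrow> prog" where
  "merge_prog l =
     zip_prog ;;
     (6 ::= Const 1 ;; 7 ::= Const (- 1)) ;; loads_prog ;;
     (6 ::= Div (Var 10) (Const l) ;; 7 ::= Const 1) ;; loads_prog ;;
     place_prog (l + 2) ;; extract_prog"

text \<open>The function computed by \<open>merge_prog\<close>. For \<open>C = 0\<close> the unit is
  \<open>0\<close>, and division by zero makes all sizes \<open>u\<close> equal to \<open>0\<close>,
  in the program as well.\<close>

definition merged ::
    "nat \<Rightarrow> nat \<Rightarrow> real \<Rightarrow> (nat \<Rightarrow> real) \<Rightarrow> (nat \<Rightarrow> nat) \<Rightarrow> (nat \<Rightarrow> nat) \<Rightarrow> nat \<Rightarrow> nat" where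
  "merged m n l p a r =
     (let C = Max (insert 0 (load_above n p a (- 1) ` {..<m})); u = (\<lambda>j. p j / (C / l)); x = load_above n u a 1
      in snd (snd (fold (place_part x u r (l + 2) (rev [0..<n])) [0..<m] (0, x 0, a))))"

lemma runs_merge_prog:
  assumes "s 1 = Num (real m)" "s 2 = enc_list p" "s 3 = enc_list (map real a)"
      "s 4 = enc_list (map real r)"
    and len: "length p = n" "length a = n" "length r = n" and a: "set a \<subseteq> {..<m}"
  shows "runs (merge_prog l) s (m * (37 * n + 24) + 8 * n + 20) (\<lambda>s'. s' 0 =
    enc_list (map real (map (merged m n (of_rat l) ((!) p) ((!) a) ((!) r)) [0..<n])))"
  unfolding merge_prog_def
proof -
  let ?js = "rev [0..<n]"
  have js: "distinct ?js" "set ?js = {..<n}" "length ?js = n" by auto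
  let ?rec = "records ((!) p) ((!) r) ((!) a) ?js"
  define C where "C = Max (insert 0 (load_above n ((!) p) ((!) a) (- 1) ` {..<m}))"
  define u where "u = (\<lambda>j. p ! j / (C / of_rat l))"
  define x where "x = load_above n u ((!) a) 1"
  have "a ! j < m" if "j < n" for j
    using subsetD[OF a nth_mem] that len by simp
  then have x: "x k = 0" if "m \<le> k" for k
    using that by (fastforce simp: x_def load_above_def intro!: sum.neutral)
  note zip = runs_zip_prog[OF assms(2,3,4) len]
  show "runs (zip_prog ;; (6 ::= Const 1 ;; 7 ::= Const (- 1)) ;; loads_prog ;;
     (6 ::= Div (Var 10) (Const l) ;; 7 ::= Const 1) ;; loads_prog ;;
     place_prog (l + 2) ;; extract_prog) s (m * (37 * n + 24) + 8 * n + 20) (\<lambda>s'. s' 0 =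
    enc_list (map real (map (merged m n (of_rat l) ((!) p) ((!) a) ((!) r)) [0..<n])))"
  proof (rule runs_Seq[OF zip, where T' = "m * (37 * n + 24) + 3 * n + 18"], rule runs_Seq)
    fix s1 :: store assume s1: "s1 1 = s 1 \<and> s1 5 = ?rec"
    show "runs (6 ::= Const 1 ;; 7 ::= Const (- 1)) s1 2
        (\<lambda>s'. s' 1 = Num (real m) \<and> s' 5 = ?rec \<and> num (s' 6) = 1 \<and> num (s' 7) = -1)"
      using s1 assms(1) by (intro runs_loop_free) (auto simp: of_rat_minus)
    fix s2 :: store assume s2: "s2 1 = Num (real m) \<and> s2 5 = ?rec \<and> num (s2 6) = 1 \<and> num (s2 7) = -1"
    then have loads: "runs loads_prog s2 (m * (9 * n + 9) + 4)
        (\<lambda>s'. num (s' 10) = C \<and> s' 1 = Num (real m) \<and> s' 5 = ?rec)"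
      using runs_loads_prog[OF js(1,2), of s2 m "(!) p" "(!) r" "(!) a" 1 "-1"]
      by (auto simp: C_def elim!: runs_mono)
    show "runs (loads_prog ;;
       (6 ::= Div (Var 10) (Const l) ;; 7 ::= Const 1) ;; loads_prog ;;
       place_prog (l + 2) ;; extract_prog) s2 (m * (37 * n + 24) + 3 * n + 16) (\<lambda>s'. s' 0 =
      enc_list (map real (map (merged m n (of_rat l) ((!) p) ((!) a) ((!) r)) [0..<n])))"
    proof (rule runs_Seq[OF loads, where T' = "m * (28 * n + 15) + 3 * n + 12"], rule runs_Seq)
      fix s3 :: store assume s3: "num (s3 10) = C \<and> s3 1 = Num (real m) \<and> s3 5 = ?rec"
      show "runs (6 ::= Div (Var 10) (Const l) ;; 7 ::= Const 1) s3 2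
        (\<lambda>s'. s' 1 = Num (real m) \<and> s' 5 = ?rec \<and> num (s' 6) = C / of_rat l \<and> num (s' 7) = 1)"
        using s3 by (intro runs_loop_free) auto
      fix s4 :: store assume s4:
        "s4 1 = Num (real m) \<and> s4 5 = ?rec \<and> num (s4 6) = C / of_rat l \<and> num (s4 7) = 1"
      then have loads: "runs loads_prog s4 (m * (9 * n + 9) + 4)
          (\<lambda>s'. s' 9 = enc_list (map x [0..<m]) \<and> s' 1 = Num (real m) \<and> s' 5 = ?rec \<and>
             num (s' 6) = C / of_rat l)"
        using runs_loads_prog[OF js(1,2), of s4 m "(!) p" "(!) r" "(!) a" "C / of_rat l" 1]
        by (auto simp: x_def u_def elim!: runs_mono)
      show "runs (loads_prog ;; place_prog (l + 2) ;; extract_prog) s4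
          (m * (28 * n + 15) + 3 * n + 10) (\<lambda>s'. s' 0 =
        enc_list (map real (map (merged m n (of_rat l) ((!) p) ((!) a) ((!) r)) [0..<n])))"
      proof (rule runs_Seq[OF loads, where T' = "m * (19 * n + 6) + 3 * n + 6"], rule runs_Seq)
        fix s5 :: store assume "s5 9 = enc_list (map x [0..<m]) \<and> s5 1 = Num (real m) \<and> s5 5 = ?rec \<and>
          num (s5 6) = C / of_rat l"
        then show "runs (place_prog (l + 2)) s5 (m * (19 * n + 6) + 4) (\<lambda>s'. s' 5 =
            records ((!) p) ((!) r) (merged m n (of_rat l) ((!) p) ((!) a) ((!) r)) ?js)"
          using runs_place_prog[where x = x and m = m and s = s5 and D = "C / of_rat l" and p = "(!) p"
              and r = "(!) r" and a = "(!) a" and T = "l + 2", OF x js(1,3)]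
          unfolding merged_def Let_def C_def[symmetric] u_def[symmetric] x_def[symmetric]
          by (simp add: of_rat_add)
        fix s6 :: store assume s6: "s6 5 =
            records ((!) p) ((!) r) (merged m n (of_rat l) ((!) p) ((!) a) ((!) r)) ?js"
        show "runs extract_prog s6 (3 * n + 2) (\<lambda>s'. s' 0 =
          enc_list (map real (map (merged m n (of_rat l) ((!) p) ((!) a) ((!) r)) [0..<n])))"
          using runs_extract_prog[where s = s6 and js = ?js, OF s6] by (simp add: comp_def)
      qed (simp_all add: algebra_simps)
    qed (simp_all add: algebra_simps)
  qed (simp_all add: algebra_simps)
qed


section \<open>The complete algorithm with predictions\<close>

definition jobs_prog :: prog where
  "jobs_prog =
     (1 ::= LeftE (RightE (Var 0)) ;; 2 ::= Const 0) ;;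
     While (Var 1) (2 ::= Add (Var 2) (Const 1) ;; 1 ::= RightE (Var 1)) ;;
     (4 ::= Var 2 ;; 3 ::= EmptyE) ;;
     While (Less (Const 0) (Var 4)) (4 ::= Sub (Var 4) (Const 1) ;; 3 ::= NodeE (Var 4) (Var 3))"

text \<open>The robust algorithm expects a list of the jobs, and the comparison of \<open>m\<close>
  with \<open>n\<close> needs \<open>n\<close>. Both are recovered from the length of the predicted
  scenario.\<close>

lemma runs_jobs_prog:
  assumes "s 0 = Node x (Node (enc_list p) d)" "length p = n"
  shows "runs jobs_prog s (6 * n + 6)
    (\<lambda>s'. s' 0 = s 0 \<and> s' 2 = Num (real n) \<and> s' 3 = enc_list (map real [0..<n]))"
proof -
  let ?count = "2 ::= Add (Var 2) (Const 1) ;; 1 ::= RightE (Var 1)"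
  let ?list = "4 ::= Sub (Var 4) (Const 1) ;; 3 ::= NodeE (Var 4) (Var 3)"
  let ?Inv1 = "\<lambda>i (s' :: store). s' 0 = s 0 \<and> s' 2 = Num (real i) \<and> s' 1 = enc_list (drop i p)"
  let ?Inv2 = "\<lambda>i (s' :: store). s' 0 = s 0 \<and> s' 2 = Num (real n) \<and> s' 4 = Num (real (n - i)) \<and>
    s' 3 = enc_list (map real [n - i..<n])"
  have 1: "runs (1 ::= LeftE (RightE (Var 0)) ;; 2 ::= Const 0) s 2 (?Inv1 0)"
    using assms by (intro runs_loop_free) auto
  have 2: "runs (While (Var 1) ?count) s' (3 * n + 1) (?Inv1 n)" if "?Inv1 0 s'" for s'
  proof (rule runs_While[where T = 2 and Inv = ?Inv1])
    fix i s' assume i: "i < n" and inv: "?Inv1 i s'"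
    have "drop i p = p ! i # drop (Suc i) p" using i assms by (simp add: Cons_nth_drop_Suc)
    then show "eval_expr (Var 1) s' \<noteq> Empty \<and> runs ?count s' 2 (?Inv1 (Suc i))"
      using inv by (intro conjI runs_loop_free) auto
  qed (use that assms in auto)
  have 3: "runs (4 ::= Var 2 ;; 3 ::= EmptyE) s' 2 (?Inv2 0)" if "?Inv1 n s'" for s'
    using that by (intro runs_loop_free) auto
  have 4: "runs (While (Less (Const 0) (Var 4)) ?list) s' (3 * n + 1) (?Inv2 n)"
    if "?Inv2 0 s'" for s'
  proof (rule runs_While[where T = 2 and Inv = ?Inv2])
    fix i s' assume i: "i < n" and inv: "?Inv2 i s'"
    have "n - i = Suc (n - Suc i)" "[n - Suc i..<n] = (n - Suc i) # [n - i..<n]"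
      using i by (simp_all add: upt_conv_Cons Suc_diff_Suc)
    then show "eval_expr (Less (Const 0) (Var 4)) s' \<noteq> Empty \<and> runs ?list s' 2 (?Inv2 (Suc i))"
      using inv i by (intro conjI runs_loop_free) auto
  qed (use that in \<open>auto simp: truth_def\<close>)
  show ?thesis unfolding jobs_prog_def
    by (rule runs_Seq[OF 1 runs_Seq[OF 2 runs_Seq[OF 3 runs_mono[OF 4 order_refl] order_refl] order_refl]]) auto
qed

text \<open>The given programs touch only variables below \<open>b\<close>, so data survives their runs in
  \<open>b\<close> to \<open>b + 2\<close>; both expect the variables other than 0 to be \<open>Empty\<close>.\<close>

definition combine_prog :: "prog \<Rightarrow> prog \<Rightarrow> nat \<Rightarrow> rat \<Rightarrow> prog" where
  "combine_prog c1 c2 b l =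
     (b ::= Var 0 ;;
      b + 1 ::= NodeE (LeftE (Var 0)) (NodeE (Var 3) (RightE (RightE (Var 0)))) ;;
      0 ::= NodeE (LeftE (Var 0)) (LeftE (RightE (Var 0)))) ;;
     clear b ;; c1 ;;
     (b + 2 ::= Var 0 ;; 0 ::= Var (b + 1)) ;;
     clear b ;; c2 ;;
     (4 ::= Var 0 ;; 3 ::= Var (b + 2) ;; 2 ::= LeftE (RightE (Var b)) ;; 1 ::= LeftE (Var b)) ;;
     merge_prog l"

text \<open>With \<open>5 \<le> b\<close>, the saved data in \<open>b\<close> to
  \<open>b + 2\<close> cannot collide with variables \<open>0\<close> to \<open>4\<close>, which
  pass the arguments. \<open>merge_prog\<close> may overwrite the saved data, as it is no longer
  needed then.\<close>

lemma runs_combine_prog: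
  assumes c1: "computes c1 (Node (Num (real m)) (enc_list p)) t1 (enc_list (map real a))"
    and c2: "computes c2 (Node (Num (real m)) (Node (enc_list (map real [0..<n])) d)) t2
      (enc_list (map real r))"
    and b: "prog_vars c1 \<subseteq> {..<b}" "prog_vars c2 \<subseteq> {..<b}" "5 \<le> b"
    and s: "s 0 = Node (Num (real m)) (Node (enc_list p) d)" "s 3 = enc_list (map real [0..<n])"
    and len: "length p = n" "length a = n" "length r = n" and a: "set a \<subseteq> {..<m}"
  shows "runs (combine_prog c1 c2 b l) s (t1 + t2 + 2 * b + m * (37 * n + 24) + 8 * n + 31) (\<lambda>s'. s' 0 =
    enc_list (map real (map (merged m n (of_rat l) ((!) p) ((!) a) ((!) r)) [0..<n])))"
    (is "runs _ _ _ ?Q")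
proof -
  let ?x1 = "Node (Num (real m)) (enc_list p)"
  let ?x2 = "Node (Num (real m)) (Node (enc_list (map real [0..<n])) d)"
  have 1: "runs (b ::= Var 0 ;;
      b + 1 ::= NodeE (LeftE (Var 0)) (NodeE (Var 3) (RightE (RightE (Var 0)))) ;;
      0 ::= NodeE (LeftE (Var 0)) (LeftE (RightE (Var 0)))) s 3
      (\<lambda>s'. s' b = s 0 \<and> s' (b + 1) = ?x2 \<and> s' 0 = ?x1)"
    using s b(3) by (intro runs_loop_free) auto
  have 2: "runs (clear b) s' (Suc b) (\<lambda>s'. (s' b = s 0 \<and> s' (b + 1) = ?x2 \<and> s' 0 = ?x1) \<and>
      (\<forall>v. 0 < v \<longrightarrow> v < b \<longrightarrow> s' v = Empty))"
    if "s' b = s 0 \<and> s' (b + 1) = ?x2 \<and> s' 0 = ?x1" for s'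
    by (rule runs_mono[OF runs_clear]) (use that b(3) in auto)
  have 3: "runs c1 s' t1 (\<lambda>s'. s' b = s 0 \<and> s' (b + 1) = ?x2 \<and> s' 0 = enc_list (map real a))"
    if "(s' b = s 0 \<and> s' (b + 1) = ?x2 \<and> s' 0 = ?x1) \<and>
      (\<forall>v. 0 < v \<longrightarrow> v < b \<longrightarrow> s' v = Empty)" for s'
    by (rule runs_mono[OF runs_computes[OF c1 b(1)]]) (use that b(3) in auto)
  have 4: "runs (b + 2 ::= Var 0 ;; 0 ::= Var (b + 1)) s' 2
      (\<lambda>s'. s' b = s 0 \<and> s' (b + 2) = enc_list (map real a) \<and> s' 0 = ?x2)"
    if "s' b = s 0 \<and> s' (b + 1) = ?x2 \<and> s' 0 = enc_list (map real a)" for s'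
    using that b(3) by (intro runs_loop_free) auto
  have 5: "runs (clear b) s' (Suc b)
      (\<lambda>s'. (s' b = s 0 \<and> s' (b + 2) = enc_list (map real a) \<and> s' 0 = ?x2) \<and>
      (\<forall>v. 0 < v \<longrightarrow> v < b \<longrightarrow> s' v = Empty))"
    if "s' b = s 0 \<and> s' (b + 2) = enc_list (map real a) \<and> s' 0 = ?x2" for s'
    by (rule runs_mono[OF runs_clear]) (use that b(3) in auto)
  have 6: "runs c2 s' t2
      (\<lambda>s'. s' b = s 0 \<and> s' (b + 2) = enc_list (map real a) \<and> s' 0 = enc_list (map real r))"
    if "(s' b = s 0 \<and> s' (b + 2) = enc_list (map real a) \<and> s' 0 = ?x2) \<and>
      (\<forall>v. 0 < v \<longrightarrow> v < b \<longrightarrow> s' v = Empty)" for s'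
    by (rule runs_mono[OF runs_computes[OF c2 b(2)]]) (use that b(3) in auto)
  have 7: "runs (4 ::= Var 0 ;; 3 ::= Var (b + 2) ;; 2 ::= LeftE (RightE (Var b)) ;;
      1 ::= LeftE (Var b)) s' 4 (\<lambda>s'. s' 1 = Num (real m) \<and> s' 2 = enc_list p \<and>
      s' 3 = enc_list (map real a) \<and> s' 4 = enc_list (map real r))"
    if "s' b = s 0 \<and> s' (b + 2) = enc_list (map real a) \<and> s' 0 = enc_list (map real r)" for s'
    using that b(3) s by (intro runs_loop_free) auto
  have 8: "runs (merge_prog l) s' (m * (37 * n + 24) + 8 * n + 20) ?Q"
    if "s' 1 = Num (real m) \<and> s' 2 = enc_list p \<and>
      s' 3 = enc_list (map real a) \<and> s' 4 = enc_list (map real r)" for s'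
    using that by (intro runs_merge_prog len a) auto
  show ?thesis unfolding combine_prog_def
    by (rule runs_Seq[OF 1 runs_Seq[OF 2 runs_Seq[OF 3 runs_Seq[OF 4 runs_Seq[OF 5
      runs_Seq[OF 6 runs_Seq[OF 7 8 order_refl] order_refl] order_refl] order_refl] order_refl]
      order_refl]]) auto
qed

definition prediction_prog :: "prog \<Rightarrow> prog \<Rightarrow> nat \<Rightarrow> rat \<Rightarrow> prog" where
  "prediction_prog c1 c2 b l =
     jobs_prog ;; If (Less (LeftE (Var 0)) (Var 2)) (combine_prog c1 c2 b l) (0 ::= Var 3)"

lemma computes_prediction_prog:
  assumes c1: "computes c1 (Node (Num (real m)) (enc_list p)) t1 (enc_list (map real a))"
    and c2: "computes c2 (Node (Num (real m)) (Node (enc_list (map real [0..<n])) d)) t2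
      (enc_list (map real r))"
    and b: "prog_vars c1 \<subseteq> {..<b}" "prog_vars c2 \<subseteq> {..<b}" "5 \<le> b"
    and len: "length p = n" "length a = n" "length r = n" and a: "set a \<subseteq> {..<m}"
  obtains t where "t \<le> t1 + t2 + 2 * b + n * (37 * n + 38) + 38"
    "computes (prediction_prog c1 c2 b l) (Node (Num (real m)) (Node (enc_list p) d)) t
      (enc_list (map real (if m < n then map (merged m n (of_rat l) ((!) p) ((!) a) ((!) r)) [0..<n]
        else [0..<n])))"
proof -
  let ?x = "Node (Num (real m)) (Node (enc_list p) d)"
  let ?Q = "\<lambda>s' :: store. s' 0 = enc_list (map real
    (if m < n then map (merged m n (of_rat l) ((!) p) ((!) a) ((!) r)) [0..<n] else [0..<n]))"
  have "runs (prediction_prog c1 c2 b l) ((\<lambda>_. Empty)(0 := ?x))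
    (t1 + t2 + 2 * b + n * (37 * n + 38) + 38) ?Q"
    unfolding prediction_prog_def
  proof (rule runs_Seq)
    show "runs jobs_prog ((\<lambda>_. Empty)(0 := ?x)) (6 * n + 6)
      (\<lambda>s'. s' 0 = ?x \<and> s' 2 = Num (real n) \<and> s' 3 = enc_list (map real [0..<n]))"
      using runs_jobs_prog[of "(\<lambda>_. Empty)(0 := ?x)"] len(1) by simp
    fix s :: store assume s: "s 0 = ?x \<and> s 2 = Num (real n) \<and> s 3 = enc_list (map real [0..<n])"
    show "runs (If (Less (LeftE (Var 0)) (Var 2)) (combine_prog c1 c2 b l) (0 ::= Var 3)) s
      (t1 + t2 + 2 * b + n * (37 * n + 32) + 32) ?Q"
    proof (rule runs_If)
      assume "eval_expr (Less (LeftE (Var 0)) (Var 2)) s \<noteq> Empty"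
      then have m: "m < n" using s by simp
      \<comment> \<open>The number \<open>m\<close> is a single leaf of the input, so only
        \<open>m < n\<close> makes a loop over the machines polynomial.\<close>
      have "m * (37 * n + 24) \<le> n * (37 * n + 24)" using m by (intro mult_le_mono1) simp
      then have "t1 + t2 + 2 * b + m * (37 * n + 24) + 8 * n + 31 \<le>
        t1 + t2 + 2 * b + n * (37 * n + 32) + 31" by (simp add: algebra_simps)
      then show "runs (combine_prog c1 c2 b l) s (t1 + t2 + 2 * b + n * (37 * n + 32) + 31) ?Q"
        using s m by (intro runs_mono[OF runs_combine_prog[OF c1 c2 b _ _ len a]]) auto
    next
      assume "eval_expr (Less (LeftE (Var 0)) (Var 2)) s = Empty"
      then show "runs (0 ::= Var 3) s (t1 + t2 + 2 * b + n * (37 * n + 32) + 31) ?Q"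
        using s by (intro runs_loop_free) auto
    qed simp
  qed (simp add: algebra_simps)
  then show thesis using that by (auto simp: runs_def computes_def)
qed


section \<open>Consistency and robustness\<close>

lemma makespan_schedule_of_le_iff:
  assumes "0 < m"
  shows "makespan (schedule_of m a) p \<le> B \<longleftrightarrow>
    (\<forall>i<m. (\<Sum>j | j < length a \<and> a ! j = i. p ! j) \<le> B)"
proof -
  have "makespan (schedule_of m a) p =
      Max ((\<lambda>i. \<Sum>j | j < length a \<and> a ! j = i. p ! j) ` {..<m})"
    unfolding makespan_def by (rule arg_cong[where f = Max], rule image_cong) (auto simp: schedule_of_def)
  moreover have "{..<m} \<noteq> {}" using assms by auto
  ultimately show ?thesis by auto
qed

lemma load_le_makespan:
  "i < m \<Longrightarrow> (\<Sum>j | j < length a \<and> a ! j = i. p ! j) \<le> makespan (schedule_of m a) p"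
  using makespan_schedule_of_le_iff[where m = m and a = a and p = p and B = "makespan (schedule_of m a) p"] by auto

lemma scenarios_nth: "p \<in> scenarios n \<Longrightarrow> j < n \<Longrightarrow> 0 \<le> p ! j"
  by (auto simp: scenarios_def)

lemma makespan_nonneg:
  assumes "0 < m" "p \<in> scenarios (length a)"
  shows "0 \<le> makespan (schedule_of m a) p"
  by (rule order_trans[OF sum_nonneg load_le_makespan[OF assms(1)]])
    (auto intro: scenarios_nth[OF assms(2)])

lemma merged_schedule:
  fixes l :: real
  assumes m: "0 < m" and l: "0 < l" and p: "p \<in> scenarios n"
    and len: "length a = n" "length r = n" and set: "set a \<subseteq> {..<m}" "set r \<subseteq> {..<m}"
  defines "f \<equiv> map (merged m n l ((!) p) ((!) a) ((!) r)) [0..<n]"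
  shows "set f \<subseteq> {..<m}"
    and "makespan (schedule_of m f) p \<le> (1 + 2 / l) * makespan (schedule_of m a) p"
    and "q \<in> scenarios n \<Longrightarrow> makespan (schedule_of m f) q \<le> (l + 2) * makespan (schedule_of m r) q"
proof -
  define C where "C = Max (insert 0 (load_above n ((!) p) ((!) a) (- 1) ` {..<m}))"
  define u where "u = (\<lambda>j. p ! j / (C / l))"
  define g where "g = merged m n l ((!) p) ((!) a) ((!) r)"
  have p0: "0 \<le> p ! j" if "j < n" for j using scenarios_nth[OF p that] .
  \<comment> \<open>Sizes are nonnegative, so the threshold \<open>-1\<close> excludes no
    job.\<close>
  have "{j. j < n \<and> a ! j = k \<and> -1 < p ! j} = {j. j < n \<and> a ! j = k}" for k
    using p0 by force
  then have load: "load_above n ((!) p) ((!) a) (- 1) k = (\<Sum>j | j < n \<and> a ! j = k. p ! j)" for k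
    by (simp add: load_above_def)
  have load_C: "(\<Sum>j | j < n \<and> a ! j = k. p ! j) \<le> C" if "k < m" for k
    unfolding C_def load[symmetric] using that by (intro Max_ge) auto
  have C_le: "C \<le> makespan (schedule_of m a) p"
    unfolding C_def using load_le_makespan[of _ m p a] makespan_nonneg[OF m, where p = p and a = a] p
    by (subst Max_le_iff) (auto simp: len load)
  have C0: "0 \<le> C" unfolding C_def by (intro Max_ge) auto
  have a_less: "a ! j < m" and r_less: "r ! j < m" if "j < n" for j
    using set(1)[THEN subsetD, OF nth_mem] set(2)[THEN subsetD, OF nth_mem] len that by simp_all
  interpret two_schedules m n u "(!) a" "(!) r" l
  proof
    show "(\<Sum>j | j < n \<and> a ! j = k. u j) \<le> l" if "k < m" for k
    \<comment> \<open>For \<open>C = 0\<close> all scaled sizes are \<open>0\<close> by division by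
      zero, and the claim is \<open>0 \<le> l\<close>.\<close>
    proof (cases "C = 0")
      case False
      then show ?thesis using load_C[OF that] C0 l
        by (simp add: u_def field_simps flip: sum_divide_distrib sum_distrib_left)
    qed (use l in \<open>simp add: u_def\<close>)
  qed (use m p0 C0 l a_less r_less in \<open>auto simp: u_def\<close>)
  have js: "distinct (rev [0..<n])" "set (rev [0..<n]) = {..<n}" by auto
  have g: "g = snd (snd (fold (place_part x u ((!) r) (l + 2) (rev [0..<n])) [0..<m] (0, x 0, (!) a)))"
    by (simp only: g_def merged_def Let_def C_def[symmetric] u_def[symmetric])
  have f_nth: "{j. j < length f \<and> f ! j = i} = {j. j < n \<and> g j = i}" for i
    by (auto simp: f_def g_def)
  show "set f \<subseteq> {..<m}"
    using merged_inv(1)[OF js g] by (auto simp: f_def g_def)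
  \<comment> \<open>Scaling back also works for \<open>C = 0\<close>: a job is at most the load of
    its machine, so its size is \<open>0\<close>.\<close>
  have p_eq: "p ! j = C / l * u j" if "j < n" for j
  proof (cases "C = 0")
    case True
    have "p ! j \<le> (\<Sum>j' | j' < n \<and> a ! j' = a ! j. p ! j')"
      using that p0 by (intro member_le_sum) auto
    then show ?thesis using load_C[OF a_less[OF that]] True p0[OF that] by simp
  qed (use l in \<open>simp add: u_def\<close>)
  show "makespan (schedule_of m f) p \<le> (1 + 2 / l) * makespan (schedule_of m a) p"
    unfolding makespan_schedule_of_le_iff[OF m] f_nth
  proof (intro allI impI)
    fix i assume "i < m"
    have "(\<Sum>j | j < n \<and> g j = i. p ! j) = C / l * (\<Sum>j | j < n \<and> g j = i. u j)"
      using p_eq by (simp add: sum_distrib_left)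
    also have "\<dots> \<le> C / l * (l + 2)"
      using merged_load[OF js g \<open>i < m\<close>] C0 l by (intro mult_left_mono) auto
    also have "\<dots> = (1 + 2 / l) * C" using l by (simp add: field_simps)
    also have "\<dots> \<le> (1 + 2 / l) * makespan (schedule_of m a) p"
      using C_le l by (intro mult_left_mono) auto
    finally show "(\<Sum>j | j < n \<and> g j = i. p ! j) \<le> (1 + 2 / l) * makespan (schedule_of m a) p" .
  qed
  show "makespan (schedule_of m f) q \<le> (l + 2) * makespan (schedule_of m r) q"
    if "q \<in> scenarios n"
    unfolding makespan_schedule_of_le_iff[OF m] f_nth
  proof (intro allI impI)
    fix i assume "i < m"
    show "(\<Sum>j | j < n \<and> g j = i. q ! j) \<le> (l + 2) * makespan (schedule_of m r) q"
      using load_le_makespan[of _ m q r] len scenarios_nth[OF that]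
      by (intro merged_robust[OF js g _ _ \<open>i < m\<close>]) auto
  qed
qed

text \<open>Each machine carries at most one job, and the machine that \<open>a\<close> gives to
  this job carries at least as much.\<close>

lemma separate_schedule:
  assumes m: "0 < m" "n \<le> m" and a: "length a = n" "set a \<subseteq> {..<m}" and p: "p \<in> scenarios n"
  shows "makespan (schedule_of m [0..<n]) p \<le> makespan (schedule_of m a) p"
  unfolding makespan_schedule_of_le_iff[OF m(1)]
proof (intro allI impI)
  fix i assume "i < m"
  show "(\<Sum>j | j < length [0..<n] \<and> [0..<n] ! j = i. p ! j) \<le> makespan (schedule_of m a) p"
  proof (cases "i < n")
    case True
    then have "{j. j < length [0..<n] \<and> [0..<n] ! j = i} = {i}" by auto
    moreover have "p ! i \<le> (\<Sum>j | j < length a \<and> a ! j = a ! i. p ! j)"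
      using True a p by (intro member_le_sum) (auto intro: scenarios_nth)
    moreover have "a ! i < m" using subsetD[OF a(2) nth_mem[of i]] True a(1) by simp
    ultimately show ?thesis using load_le_makespan[of "a ! i" m p a] by simp
  next
    case False
    then have "{j. j < length [0..<n] \<and> [0..<n] ! j = i} = {}" by auto
    then show ?thesis using makespan_nonneg[OF m(1), where p = p and a = a] a p by (simp only: sum.empty)
  qed
qed

text \<open>The supremum is an upper bound once the values are bounded: a common bound
  \<open>b\<close> on the job sizes bounds every makespan by \<open>n * b\<close>.\<close>

lemma makespan_le_worst_makespan:
  assumes V: "uncertainty_set n V" and m: "0 < m" and a: "length a = n" and p: "p \<in> V"
  shows "makespan (schedule_of m a) p \<le> worst_makespan (schedule_of m a) V"
proof -
  obtain b where b: "V \<subseteq> scenarios n" "\<And>p x. p \<in> V \<Longrightarrow> x \<in> set p \<Longrightarrow> x \<le> b"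
    using V by (auto simp: uncertainty_set_def)
  have "makespan (schedule_of m a) q \<le> n * b" if q: "q \<in> V" for q
    unfolding makespan_schedule_of_le_iff[OF m] a
  proof (intro allI impI)
    fix i
    have "(\<Sum>j | j < n \<and> a ! j = i. q ! j) \<le> (\<Sum>j<n. q ! j)"
      using b(1) q by (intro sum_mono2) (auto intro: scenarios_nth)
    also have "\<dots> \<le> (\<Sum>j<n. b)"
      using b q by (intro sum_mono b(2)[OF q] nth_mem) (auto simp: scenarios_def)
    finally show "(\<Sum>j | j < n \<and> a ! j = i. q ! j) \<le> n * b" by simp
  qed
  then have "bdd_above (makespan (schedule_of m a) ` V)"
    by (intro bdd_aboveI2) auto
  then show ?thesis unfolding worst_makespan_def using p by (rule cSUP_upper2) simp
qed

section \<open>Polynomial running time and the final guarantees\<close>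

lemma poly_nat_mono: "x \<le> y \<Longrightarrow> poly q x \<le> poly q y" for q :: "nat poly"
  by (induction q) (auto intro: add_mono mult_mono)

theorem corollary28:
  fixes \<gamma> \<gamma>_rob :: real
    and I :: "(nat \<times> nat \<times> data) set"
    and U :: "data \<Rightarrow> real list set"
  assumes "\<And>m n d. (m, n, d) \<in> I \<Longrightarrow> 1 \<le> m \<and> uncertainty_set n (U d)"
    and "\<exists>c. makespan_approx_algorithm \<gamma> c"
    and "\<exists>c. robust_approx_algorithm I U \<gamma>_rob c"
  shows "\<forall>lam>0. \<exists>c. prediction_algorithm I U (\<gamma> * (1 + 2 / lam)) ((2 * lam + 4) * \<gamma>_rob) c"
proof (intro allI impI)
  fix lam :: real assume "0 < lam"
  \<comment> \<open>The lower limit gives \<open>1 + 2 / L \<le> 1 + 2 / lam\<close> for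
    consistency, the upper limit \<open>L + 2 \<le> 2 * lam + 4\<close> for robustness.\<close>
  then obtain l where l: "lam < of_rat l" "of_rat l < 2 * lam + 2"
    using of_rat_dense[of lam "2 * lam + 2"] by auto
  define L :: real where "L = of_rat l"
  have L: "0 < L" "lam \<le> L" "L + 2 \<le> 2 * lam + 4" using l \<open>0 < lam\<close> unfolding L_def by linarith+
  obtain c1 c2 where c: "makespan_approx_algorithm \<gamma> c1" "robust_approx_algorithm I U \<gamma>_rob c2"
    using assms(2,3) by auto
  obtain q1 :: "nat poly" where c1: "\<And>m p. 1 \<le> m \<Longrightarrow> p \<in> scenarios (length p) \<Longrightarrow>
      \<exists>t y. computes c1 (Node (enc_nat m) (enc_list p)) t y \<and>
        t \<le> poly q1 (data_size (Node (enc_nat m) (enc_list p))) \<and>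
        (\<exists>S. represents m (length p) y S \<and> makespan S p \<le> \<gamma> * OPT m p)"
    using c(1)
    unfolding makespan_approx_algorithm_def solves_in_poly_time_def Ball_def split_paired_All
      mem_Collect_eq prod.case by blast
  obtain q2 :: "nat poly" where c2: "\<And>m n d. (m, n, d) \<in> I \<Longrightarrow>
      \<exists>t y. computes c2 (Node (enc_nat m) (Node (enc_list (map real [0..<n])) d)) t y \<and>
        t \<le> poly q2 (data_size (Node (enc_nat m) (Node (enc_list (map real [0..<n])) d))) \<and>
        (\<exists>S. represents m n y S \<and> worst_makespan S (U d) \<le> \<gamma>_rob * OPT_rob m n (U d))"
    using c(2)
    unfolding robust_approx_algorithm_def solves_in_poly_time_def Ball_def split_paired_All
      prod.case by blast
  obtain b0 where "prog_vars c1 \<union> prog_vars c2 \<subseteq> {..<b0}"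
    using finite_prog_vars by (metis finite_UnI finite_nat_iff_bounded)
  then obtain b where b: "prog_vars c1 \<subseteq> {..<b}" "prog_vars c2 \<subseteq> {..<b}" "5 \<le> b"
    by (intro that[of "b0 + 5"]) auto
  \<comment> \<open>The last summand is \<open>37 * N^2 + 38 * N + 2 * b + 38\<close>, the overhead
    in \<open>computes_prediction_prog\<close> with the input size \<open>N\<close> in place of
    \<open>n\<close>.\<close>
  define q where "q = q1 + q2 + [:2 * b + 38, 38, 37:]"
  have "\<exists>t y. computes (prediction_prog c1 c2 b l) (Node (enc_nat m) (Node (enc_list p) d)) t y \<and>
      t \<le> poly q (data_size (Node (enc_nat m) (Node (enc_list p) d))) \<and>
      (\<exists>S. represents m n y S \<and> makespan S p \<le> \<gamma> * (1 + 2 / lam) * OPT m p \<and>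
        worst_makespan S (U d) \<le> (2 * lam + 4) * \<gamma>_rob * OPT_rob m n (U d))"
    if I: "(m, n, d) \<in> I" and p: "p \<in> U d" for m n d p
  proof -
    have m: "0 < m" "1 \<le> m" and U: "uncertainty_set n (U d)" using assms(1)[OF I] by auto
    then have sub: "U d \<subseteq> scenarios n" by (simp add: uncertainty_set_def)
    then have ps: "p \<in> scenarios n" using p by auto
    then have n: "length p = n" by (simp add: scenarios_def)
    let ?N = "data_size (Node (enc_nat m) (Node (enc_list p) d))"
    obtain t1 a where a: "computes c1 (Node (Num (real m)) (enc_list p)) t1 (enc_list (map real a))"
      "t1 \<le> poly q1 (data_size (Node (enc_nat m) (enc_list p)))"
      "length a = n" "set a \<subseteq> {..<m}" "makespan (schedule_of m a) p \<le> \<gamma> * OPT m p"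
      using c1[OF m(2), of p] ps n by (auto simp: represents_def enc_nat_def)
    obtain t2 r where r: "computes c2 (Node (Num (real m)) (Node (enc_list (map real [0..<n])) d)) t2
        (enc_list (map real r))"
      "t2 \<le> poly q2 (data_size (Node (enc_nat m) (Node (enc_list (map real [0..<n])) d)))"
      "length r = n" "set r \<subseteq> {..<m}"
      "worst_makespan (schedule_of m r) (U d) \<le> \<gamma>_rob * OPT_rob m n (U d)"
      using c2[OF I] by (auto simp: represents_def enc_nat_def)
    define f where "f = (if m < n then map (merged m n L ((!) p) ((!) a) ((!) r)) [0..<n] else [0..<n])"
    obtain t where t: "t \<le> t1 + t2 + 2 * b + n * (37 * n + 38) + 38"
      "computes (prediction_prog c1 c2 b l) (Node (enc_nat m) (Node (enc_list p) d)) t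
        (enc_list (map real f))"
      unfolding enc_nat_def f_def L_def
      by (rule computes_prediction_prog[OF a(1) r(1) b n a(3) r(3) a(4)])
    \<comment> \<open>Neither given algorithm gets an input larger than the whole input: the job
      list is as long as the predicted scenario.\<close>
    have "t1 \<le> poly q1 ?N"
      using a(2) by (rule order_trans) (auto intro!: poly_nat_mono)
    moreover have "t2 \<le> poly q2 ?N"
      using r(2) by (rule order_trans) (auto intro!: poly_nat_mono simp: data_size_enc_list n)
    moreover have "n * (37 * n + 38) \<le> ?N * (37 * ?N + 38)"
      by (intro mult_le_mono add_le_mono) (auto simp: data_size_enc_list n)
    ultimately have time: "t \<le> poly q ?N"
      using t(1) by (simp add: q_def algebra_simps)
    let ?A = "makespan (schedule_of m a)" and ?R = "makespan (schedule_of m r)"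
      and ?F = "makespan (schedule_of m f)"
    have pos: "0 \<le> ?A p" "\<And>p'. p' \<in> U d \<Longrightarrow> 0 \<le> ?R p'"
      using makespan_nonneg[OF m(1)] ps sub a(3) r(3) by auto
    have f: "set f \<subseteq> {..<m}" "length f = n" "?F p \<le> (1 + 2 / L) * ?A p"
      "\<And>p'. p' \<in> U d \<Longrightarrow> ?F p' \<le> (L + 2) * ?R p'"
    proof -
      have "set f \<subseteq> {..<m} \<and> ?F p \<le> (1 + 2 / L) * ?A p \<and> (\<forall>p'\<in>U d. ?F p' \<le> (L + 2) * ?R p')"
      proof (cases "m < n")
        case True
        then show ?thesis
          using merged_schedule[OF m(1) L(1) ps a(3) r(3) a(4) r(4)] sub by (auto simp: f_def)
      next
        case False
        then have "?F p \<le> 1 * ?A p" "\<forall>p'\<in>U d. ?F p' \<le> 1 * ?R p'"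
          using separate_schedule[OF m(1)] a r ps sub by (auto simp: f_def)
        \<comment> \<open>For \<open>n \<le> m\<close> both factors are \<open>1\<close>;
          nonnegative makespans allow them to be raised to those of the main case.\<close>
        moreover have "1 * ?A p \<le> (1 + 2 / L) * ?A p" "\<forall>p'\<in>U d. 1 * ?R p' \<le> (L + 2) * ?R p'"
          using L pos by (auto intro!: mult_right_mono simp del: mult_1)
        ultimately show ?thesis using False by (fastforce simp: f_def)
      qed
      then show "set f \<subseteq> {..<m}" "?F p \<le> (1 + 2 / L) * ?A p"
        "\<And>p'. p' \<in> U d \<Longrightarrow> ?F p' \<le> (L + 2) * ?R p'" by auto
      show "length f = n" by (simp add: f_def)
    qed
    have "?F p \<le> (1 + 2 / lam) * (\<gamma> * OPT m p)"
    proof -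
      have "(1 + 2 / L) * ?A p \<le> (1 + 2 / lam) * (\<gamma> * OPT m p)"
        using L \<open>0 < lam\<close> pos(1) a(5) by (intro mult_mono add_left_mono divide_left_mono) auto
      then show ?thesis using f(3) by linarith
    qed
    moreover have "worst_makespan (schedule_of m f) (U d) \<le> (2 * lam + 4) * (\<gamma>_rob * OPT_rob m n (U d))"
      unfolding worst_makespan_def
    proof (rule cSUP_least)
      fix p' assume p': "p' \<in> U d"
      have "?R p' \<le> \<gamma>_rob * OPT_rob m n (U d)"
        using makespan_le_worst_makespan[OF U m(1) r(3) p'] r(5) by linarith
      then have "(L + 2) * ?R p' \<le> (2 * lam + 4) * (\<gamma>_rob * OPT_rob m n (U d))"
        using L \<open>0 < lam\<close> pos(2)[OF p'] by (intro mult_mono) auto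
      then show "?F p' \<le> (2 * lam + 4) * (\<gamma>_rob * OPT_rob m n (U d))" using f(4)[OF p'] by linarith
    qed (use p in auto)
    ultimately show ?thesis using t(2) time f(1,2)
      by (intro exI[of _ t] exI[of _ "enc_list (map real f)"] conjI exI[of _ "schedule_of m f"])
        (auto simp: represents_def mult_ac)
  qed
  then have "prediction_algorithm I U (\<gamma> * (1 + 2 / lam)) ((2 * lam + 4) * \<gamma>_rob)
      (prediction_prog c1 c2 b l)"
    unfolding prediction_algorithm_def solves_in_poly_time_def by (intro exI[of _ q]) auto
  then show "\<exists>c. prediction_algorithm I U (\<gamma> * (1 + 2 / lam)) ((2 * lam + 4) * \<gamma>_rob) c" ..
qed

end
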